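(* Let $\mathbb{k}$ be a field, $S=\mathbb{k}[x_1,\ldots,x_n]$, and let $I\subsetneq S$ be a proper homogeneous ideal with linear powers, generated in degree $d$. For an integer $k\ge 1$ define the column vector $\beta^{(k)}=(\beta_i(S/I^k))_{1\le i\le n}$. Then, for every $k\geq 1$, $$\left[(-1)^{i+j}\binom{j}{i}\right]_{\substack{0\le i<n-\dim I\\ 0\le j<n}}\beta^{(k)}=\left[\binom{dk+i-1}{i}\right]_{0\le i<n-\dim I}.$$ That is, for every $0\le i<n-\dim I$, $\sum_{j=0}^{n-1}(-1)^{i+j}\binom{j}{i}\beta_{j+1}(S/I^k)=\binom{dk+i-1}{i}$.
   Context: $S$ is standard graded. For a homogeneous ideal $J\subset S$, the Betti numbers $\beta_i(S/J)$ are the ranks of the free modules in a minimal graded free resolution $0\to S^{\beta_n}\to\cdots\to S^{\beta_1}\to S\to S/J\to 0$. "Generated in degree $d$" means that all minimal homogeneous generators have degree $d$. A homogeneous ideal $J$ has linear resolution if all maps $\partial_i:S^{\beta_i}\to S^{\beta_{i-1}}$ with $i>1$ in a minimal graded free resolution of $S/J$ are represented by matrices whose non-zero entries have degree one. The ideal $I$ has linear powers if $I^k$ has linear resolution for all integers $k\ge1$. $\dim I$ denotes the Krull dimension of $S/I$. Convention: $\binom{j}{i}=0$ when $i>j$. $[c_{ij}]$ denotes the matrix with entry $c_{ij}$ in row $i$, column $j$, and $[c_i]$ denotes a column vector. *)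

theory Defs
  imports
    "HOL-Library.Poly_Mapping"
    "HOL-Library.Extended_Nat"
    "HOL-Library.Cardinality"
    "HOL-Algebra.Ideal_Product"
    "HOL-Algebra.QuotRing"
    "Jordan_Normal_Form.Matrix_Kernel"
begin

text \<open>
  Polynomials over \<open>'k\<close> with one variable for each element of the finite index type \<open>'n\<close>, so the
  number of variables is \<open>CARD('n)\<close>. The ring structure is that of \<^typ>\<open>'a \<Rightarrow>\<^sub>0 'b\<close>; the abbreviation
  \<^term>\<open>class_ring\<close> turns it into a ring record, through which ideals, ideal products and quotient
  rings are those of HOL-Algebra.
\<close>

type_synonym ('n, 'k) mpoly = "('n \<Rightarrow>\<^sub>0 nat) \<Rightarrow>\<^sub>0 'k"

definition monom_degree :: "('n::finite \<Rightarrow>\<^sub>0 nat) \<Rightarrow> nat" where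
  "monom_degree m = (\<Sum>x\<in>UNIV. Poly_Mapping.lookup m x)"

text \<open>The graded component of degree \<open>d\<close>: it contains 0 for every \<open>d\<close>, and is zero for \<open>d < 0\<close>.\<close>

definition homogeneous_of_degree :: "int \<Rightarrow> ('n::finite, 'k::field) mpoly \<Rightarrow> bool" where
  "homogeneous_of_degree d f \<longleftrightarrow> (\<forall>m\<in>Poly_Mapping.keys f. int (monom_degree m) = d)"

definition homogeneous_generating_set ::
    "('n::finite, 'k::field) mpoly set \<Rightarrow> ('n, 'k) mpoly set \<Rightarrow> bool" where
  "homogeneous_generating_set J G \<longleftrightarrow>
     (\<forall>g\<in>G. \<exists>d. homogeneous_of_degree d g) \<and> genideal class_ring G = J"

definition homogeneous_ideal :: "('n::finite, 'k::field) mpoly set \<Rightarrow> bool" where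
  "homogeneous_ideal J \<longleftrightarrow> ideal J class_ring \<and> (\<exists>G. homogeneous_generating_set J G)"

definition minimal_homogeneous_generating_set ::
    "('n::finite, 'k::field) mpoly set \<Rightarrow> ('n, 'k) mpoly set \<Rightarrow> bool" where
  "minimal_homogeneous_generating_set J G \<longleftrightarrow>
     homogeneous_generating_set J G \<and> (\<forall>H. H \<subset> G \<longrightarrow> \<not> homogeneous_generating_set J H)"

definition generated_in_degree :: "nat \<Rightarrow> ('n::finite, 'k::field) mpoly set \<Rightarrow> bool" where
  "generated_in_degree d J \<longleftrightarrow>
     (\<forall>G. minimal_homogeneous_generating_set J G \<longrightarrow> (\<forall>g\<in>G. homogeneous_of_degree (int d) g))"

abbreviation ideal_power :: "('n::finite, 'k::field) mpoly set \<Rightarrow> nat \<Rightarrow> ('n, 'k) mpoly set" where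
  "ideal_power J k \<equiv> J [^]\<^bsub>ideals_set class_ring\<^esub> k"

definition mat_image :: "'a::comm_ring_1 mat \<Rightarrow> 'a vec set" where
  "mat_image A = {A *\<^sub>v v | v. v \<in> carrier_vec (dim_col A)}"

text \<open>
  A graded free resolution \<open>0 \<rightarrow> F\<^sub>n \<rightarrow> \<dots> \<rightarrow> F\<^sub>1 \<rightarrow> F\<^sub>0 = S \<rightarrow> S/J \<rightarrow> 0\<close> of length \<open>n = CARD('n)\<close>, where
  \<open>F\<^sub>i\<close> has rank \<open>r i\<close> (possibly 0), its \<open>q\<close>-th basis element has degree \<open>e i q\<close>, and
  \<open>A i\<close> is the matrix of \<open>F\<^sub>i \<rightarrow> F\<^sub>i\<^sub>-\<^sub>1\<close> acting on column vectors. As \<open>F\<^sub>i = 0\<close> for \<open>i > n\<close>, exactness at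
  \<open>F\<^sub>n\<close> says that the kernel of \<open>A n\<close> is zero.
\<close>

definition graded_free_resolution ::
    "('n::finite, 'k::field) mpoly set \<Rightarrow> (nat \<Rightarrow> nat) \<Rightarrow> (nat \<Rightarrow> nat \<Rightarrow> int)
       \<Rightarrow> (nat \<Rightarrow> ('n, 'k) mpoly mat) \<Rightarrow> bool" where
  "graded_free_resolution J r e A \<longleftrightarrow>
     r 0 = 1 \<and> e 0 0 = 0 \<and> (\<forall>i. CARD('n) < i \<longrightarrow> r i = 0) \<and>
     (\<forall>i. A (Suc i) \<in> carrier_mat (r i) (r (Suc i))) \<and>
     (\<forall>i. \<forall>p<r i. \<forall>q<r (Suc i). homogeneous_of_degree (e (Suc i) q - e i p) (A (Suc i) $$ (p, q))) \<and>
     {v $ 0 | v. v \<in> mat_image (A 1)} = J \<and>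
     (\<forall>i\<ge>1. mat_kernel (A i) = mat_image (A (Suc i)))"

text \<open>
  Minimality: the image of every \<open>F\<^sub>i\<^sub>+\<^sub>1 \<rightarrow> F\<^sub>i\<close> lies in \<open>(x\<^sub>1, \<dots>, x\<^sub>n) F\<^sub>i\<close>, that is, all matrix entries
  have zero constant term.
\<close>

definition minimal_graded_free_resolution ::
    "('n::finite, 'k::field) mpoly set \<Rightarrow> (nat \<Rightarrow> nat) \<Rightarrow> (nat \<Rightarrow> nat \<Rightarrow> int)
       \<Rightarrow> (nat \<Rightarrow> ('n, 'k) mpoly mat) \<Rightarrow> bool" where
  "minimal_graded_free_resolution J r e A \<longleftrightarrow>
     graded_free_resolution J r e A \<and>
     (\<forall>i. \<forall>p<r i. \<forall>q<r (Suc i). Poly_Mapping.lookup (A (Suc i) $$ (p, q)) 0 = 0)"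

text \<open>The number \<open>\<beta>\<^sub>i(S/J)\<close>; note that the argument is the ideal \<open>J\<close>.\<close>

definition betti :: "nat \<Rightarrow> ('n::finite, 'k::field) mpoly set \<Rightarrow> nat" where
  "betti i J = (THE b. \<exists>r e A. minimal_graded_free_resolution J r e A \<and> r i = b)"

definition has_linear_resolution :: "('n::finite, 'k::field) mpoly set \<Rightarrow> bool" where
  "has_linear_resolution J \<longleftrightarrow>
     (\<exists>r e A. minimal_graded_free_resolution J r e A \<and>
        (\<forall>i>1. \<forall>p<r (i - 1). \<forall>q<r i.
           A i $$ (p, q) \<noteq> 0 \<longrightarrow> homogeneous_of_degree 1 (A i $$ (p, q))))"

definition has_linear_powers :: "('n::finite, 'k::field) mpoly set \<Rightarrow> bool" where
  "has_linear_powers J \<longleftrightarrow> (\<forall>k\<ge>1. has_linear_resolution (ideal_power J k))"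

text \<open>
  The supremum of the lengths of chains of prime ideals, with value \<^term>\<open>0\<close> for the zero ring
  (which has no prime ideals).
\<close>

definition krull_dim :: "('a, 'b) ring_scheme \<Rightarrow> enat" where
  "krull_dim R = Sup {enat l | l. \<exists>P. (\<forall>i\<le>l. primeideal (P i) R) \<and> (\<forall>i<l. P i \<subset> P (Suc i))}"

abbreviation ideal_dim :: "('n::finite, 'k::field) mpoly set \<Rightarrow> enat" where
  "ideal_dim J \<equiv> krull_dim (class_ring Quot J)"

end

theory Submission
  imports
    Defs
    "Jordan_Normal_Form.Determinant"
    "HOL-Library.Function_Algebras"
    "HOL-Computational_Algebra.Polynomial_FPS"
begin

text \<open>
  Linearity forces the \<open>i\<close>-th module of the resolution of \<open>S / I\<^sup>k\<close> to be generated in degree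
  \<open>d k + i - 1\<close>, so the Hilbert series of \<open>S / I\<^sup>k\<close> is \<open>K(t) / (1 - t)\<^sup>n\<close> with
  \<open>K(t) = 1 - t\<^sup>d\<^sup>k (\<Sum>j<n. (-1)\<^sup>j \<beta>\<^sub>j\<^sub>+\<^sub>1 t\<^sup>j)\<close>. If \<open>K\<close> vanishes to order \<open>c = n - dim I\<close> at \<open>1\<close>, then the
  claim is read off from the coefficients of \<open>u\<^sup>i\<close>, \<open>i < c\<close>, after substituting \<open>t = 1 - u\<close>.

  The order of vanishing only needs an upper bound for the number of monomials that are not leading
  monomials of \<open>I\<^sup>k\<close>. Such a bound fails only if the leading monomials avoid a polynomial subring in
  more than \<open>dim I\<close> variables, and with the lexicographically smallest monomial as leading monomial
  a set \<open>U\<close> of variables that is avoided yields a chain of primes of length \<open>card U\<close> above \<open>I\<^sup>k\<close>, by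
  adjoining the variables of \<open>U\<close> one after the other.
\<close>

subsection \<open>Leading monomials and chains of primes\<close>

text \<open>Every ingredient is a one-sided estimate. The identity is claimed for i < n - dim I, so
  K has to vanish at 1 to order at least c. Two inequalities give this: in each degree there are at
  most as many leading monomials as the dimension of that part of I^k, which is linear independence;
  and a set of variables avoided by the leading monomials has at most dim I elements, which is the
  construction of primes. The order of vanishing is measured at real t in (0,1). Hilbert series have
  non-negative terms there and can be compared term by term, and a bound C / (1-t)^(dim I) for the
  monomials that are not leading becomes |K(t)| <= C (1-t)^c. One bound serves all powers, because a
  prime containing I^k contains I. Linearity makes K a polynomial in the Betti numbers alone: each
  module of the resolution is generated in a single degree, so no finer graded Betti numbers
  appear.\<close>

text \<open>The lexicographic order needs a linearly ordered index set, and the variables are only a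
  finite type; exponents are therefore transported to \<open>nat\<close> along an injection
  \<open>\<iota>\<close>.\<close>

definition lexkey :: "('n::finite \<Rightarrow> nat) \<Rightarrow> ('n \<Rightarrow>\<^sub>0 nat) \<Rightarrow> (nat \<Rightarrow>\<^sub>0 nat)" where
  "lexkey \<iota> \<mu> = (\<Sum>x\<in>UNIV. Poly_Mapping.single (\<iota> x) (Poly_Mapping.lookup \<mu> x))"

lemma lookup_lexkey:
  assumes "inj \<iota>"
  shows "Poly_Mapping.lookup (lexkey \<iota> \<mu>) (\<iota> x) = Poly_Mapping.lookup \<mu> x"
proof -
  have "Poly_Mapping.lookup (lexkey \<iota> \<mu>) (\<iota> x)
      = (\<Sum>y\<in>UNIV. if y = x then Poly_Mapping.lookup \<mu> x else 0)"
    unfolding lexkey_def lookup_sum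
    using assms by (intro sum.cong) (auto simp: lookup_single when_def inj_eq)
  then show ?thesis by simp
qed

lemma lookup_lexkey_outside:
  "i \<notin> range \<iota> \<Longrightarrow> Poly_Mapping.lookup (lexkey \<iota> \<mu>) i = 0"
  unfolding lexkey_def lookup_sum by (intro sum.neutral) (auto simp: lookup_single when_def)

lemma lexkey_add: "lexkey \<iota> (\<mu> + \<nu>) = lexkey \<iota> \<mu> + lexkey \<iota> \<nu>"
  unfolding lexkey_def by (simp add: lookup_add single_add sum.distrib)

lemma less_poly_mapping_iff:
  "(p :: nat \<Rightarrow>\<^sub>0 nat) < q \<longleftrightarrow>
     (\<exists>k. Poly_Mapping.lookup p k < Poly_Mapping.lookup q k \<and>
        (\<forall>k'<k. Poly_Mapping.lookup p k' = Poly_Mapping.lookup q k'))"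
  by (simp add: less_poly_mapping.rep_eq less_fun_def)

text \<open>
  The leading monomial is the lexicographically \<^emph>\<open>smallest\<close> one, with the variable of least index
  \<open>\<iota>\<close> first; on homogeneous polynomials of a fixed degree this is the reverse lexicographic order.
\<close>

definition is_lead :: "('n::finite \<Rightarrow> nat) \<Rightarrow> ('n, 'k::field) mpoly \<Rightarrow> ('n \<Rightarrow>\<^sub>0 nat) \<Rightarrow> bool" where
  "is_lead \<iota> f \<mu> \<longleftrightarrow> \<mu> \<in> Poly_Mapping.keys f \<and>
     (\<forall>\<nu>\<in>Poly_Mapping.keys f. \<nu> \<noteq> \<mu> \<longrightarrow> lexkey \<iota> \<mu> < lexkey \<iota> \<nu>)"

text \<open>Splitting one term off \<open>f\<close> and one off \<open>g\<close> leaves products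
  that cannot contain \<open>\<mu> + \<nu>\<close>. This serves leading monomials and also constant
  terms, where 0 = 0 + 0 is the only decomposition.\<close>

lemma lookup_mult_extreme:
  fixes f g :: "('n::finite, 'k::field) mpoly"
  assumes "\<And>\<alpha> \<beta>. \<alpha> \<in> Poly_Mapping.keys f \<Longrightarrow> \<beta> \<in> Poly_Mapping.keys g \<Longrightarrow>
      \<alpha> + \<beta> = \<mu> + \<nu> \<Longrightarrow> \<alpha> = \<mu> \<and> \<beta> = \<nu>"
  shows "Poly_Mapping.lookup (f * g) (\<mu> + \<nu>) = Poly_Mapping.lookup f \<mu> * Poly_Mapping.lookup g \<nu>"
proof -
  let ?a = "Poly_Mapping.single \<mu> (Poly_Mapping.lookup f \<mu>)"
  let ?b = "Poly_Mapping.single \<nu> (Poly_Mapping.lookup g \<nu>)"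
  have 1: "Poly_Mapping.lookup (f - ?a) \<alpha> = (if \<alpha> = \<mu> then 0 else Poly_Mapping.lookup f \<alpha>)" for \<alpha>
    by (simp add: lookup_minus lookup_single when_def)
  have 2: "Poly_Mapping.lookup (g - ?b) \<alpha> = (if \<alpha> = \<nu> then 0 else Poly_Mapping.lookup g \<alpha>)" for \<alpha>
    by (simp add: lookup_minus lookup_single when_def)
  have "f * g = ?a * ?b + ?a * (g - ?b) + (f - ?a) * g"
    by (simp add: algebra_simps)
  moreover have "Poly_Mapping.lookup (?a * (g - ?b)) (\<mu> + \<nu>) = 0"
  proof (rule ccontr)
    assume "Poly_Mapping.lookup (?a * (g - ?b)) (\<mu> + \<nu>) \<noteq> 0"
    then have "\<mu> + \<nu> \<in> Poly_Mapping.keys (?a * (g - ?b))" by (simp add: in_keys_iff)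
    then obtain \<alpha> \<beta> where "\<mu> + \<nu> = \<alpha> + \<beta>" "\<alpha> \<in> Poly_Mapping.keys ?a" "\<beta> \<in> Poly_Mapping.keys (g - ?b)"
      using keys_mult by blast
    then show False using assms[of \<alpha> \<beta>] 2[of \<beta>]
      by (auto simp: in_keys_iff lookup_single when_def split: if_splits)
  qed
  moreover have "Poly_Mapping.lookup ((f - ?a) * g) (\<mu> + \<nu>) = 0"
  proof (rule ccontr)
    assume "Poly_Mapping.lookup ((f - ?a) * g) (\<mu> + \<nu>) \<noteq> 0"
    then have "\<mu> + \<nu> \<in> Poly_Mapping.keys ((f - ?a) * g)" by (simp add: in_keys_iff)
    then obtain \<alpha> \<beta> where "\<mu> + \<nu> = \<alpha> + \<beta>" "\<alpha> \<in> Poly_Mapping.keys (f - ?a)" "\<beta> \<in> Poly_Mapping.keys g"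
      using keys_mult by blast
    then show False using assms[of \<alpha> \<beta>] 1[of \<alpha>]
      by (auto simp: in_keys_iff split: if_splits)
  qed
  ultimately show ?thesis
    by (simp add: lookup_add mult_single)
qed

text \<open>The order is compatible with adding exponents and a field has no zero divisors. Hence
  the polynomials with leading monomial in given variables form a multiplicative set.\<close>

lemma is_lead_mult:
  fixes f g :: "('n::finite, 'k::field) mpoly"
  assumes "inj \<iota>" and f: "is_lead \<iota> f \<mu>" and g: "is_lead \<iota> g \<nu>"
  shows "is_lead \<iota> (f * g) (\<mu> + \<nu>)"
proof -
  have lt: "lexkey \<iota> (\<mu> + \<nu>) < lexkey \<iota> (\<alpha> + \<beta>)"
    if "\<alpha> \<in> Poly_Mapping.keys f" "\<beta> \<in> Poly_Mapping.keys g" "\<not> (\<alpha> = \<mu> \<and> \<beta> = \<nu>)" for \<alpha> \<beta>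
    using that f g unfolding lexkey_add is_lead_def
    by (metis add_less_le_mono add_le_less_mono less_imp_le order_refl)
  have "Poly_Mapping.lookup (f * g) (\<mu> + \<nu>) = Poly_Mapping.lookup f \<mu> * Poly_Mapping.lookup g \<nu>"
    by (rule lookup_mult_extreme) (use lt in force)
  moreover have "\<dots> \<noteq> 0" using f g by (simp add: is_lead_def in_keys_iff)
  ultimately have "\<mu> + \<nu> \<in> Poly_Mapping.keys (f * g)" by (simp add: in_keys_iff)
  then show ?thesis unfolding is_lead_def using keys_mult[of f g] lt by fastforce
qed

text \<open>The first positive exponent of \<open>\<nu>\<close> occurs at an index at most
  \<open>\<iota> x\<close>, while \<open>\<mu>\<close> has only zeros up to there, so the first
  difference is in favour of \<open>\<nu>\<close>.\<close>

lemma lexkey_less_of_variable: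
  assumes "inj \<iota>" and "\<And>y. y \<in> Poly_Mapping.keys \<mu> \<Longrightarrow> \<iota> x < \<iota> y"
    and "Poly_Mapping.lookup \<nu> x > 0"
  shows "lexkey \<iota> \<mu> < lexkey \<iota> \<nu>"
proof -
  have z: "Poly_Mapping.lookup (lexkey \<iota> \<mu>) i = 0" if "i \<le> \<iota> x" for i
  proof (cases "i \<in> range \<iota>")
    case True
    then obtain y where "i = \<iota> y" by blast
    then have "y \<notin> Poly_Mapping.keys \<mu>" using assms(2) that by fastforce
    then show ?thesis using \<open>i = \<iota> y\<close> lookup_lexkey[OF assms(1)] by (simp add: in_keys_iff)
  qed (simp add: lookup_lexkey_outside)
  define k where "k = (LEAST i. Poly_Mapping.lookup (lexkey \<iota> \<nu>) i > 0)"
  have ex: "Poly_Mapping.lookup (lexkey \<iota> \<nu>) (\<iota> x) > 0"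
    using assms lookup_lexkey by metis
  have k1: "Poly_Mapping.lookup (lexkey \<iota> \<nu>) k > 0" "k \<le> \<iota> x"
    unfolding k_def using ex by (rule LeastI, rule Least_le)
  have "Poly_Mapping.lookup (lexkey \<iota> \<nu>) i = 0" if "i < k" for i
    using not_less_Least[OF that[unfolded k_def]] by simp
  then show ?thesis unfolding less_poly_mapping_iff
    using k1 z by (intro exI[of _ k]) auto
qed

section \<open>Ideals and primes of a commutative ring\<close>

lemma class_ring_idealI:
  fixes I :: "'a::comm_ring_1 set"
  assumes "0 \<in> I" "\<And>a b. a \<in> I \<Longrightarrow> b \<in> I \<Longrightarrow> a + b \<in> I" "\<And>a s. a \<in> I \<Longrightarrow> s * a \<in> I"
  shows "ideal I class_ring"
proof (rule idealI)
  show "ring (class_ring :: 'a ring)" by (rule class_ring.ring_axioms)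
  have "subgroup I (add_monoid (class_ring :: 'a ring))"
  proof (rule group.subgroupI)
    show "group (add_monoid (class_ring :: 'a ring))"
      by (rule abelian_group.a_group[OF ring.is_abelian_group[OF class_ring.ring_axioms]])
    fix a assume "a \<in> I"
    then have "(\<ominus>\<^bsub>class_ring\<^esub> a) \<in> I"
      using assms(3)[of a "-1"] by (simp add: class_ring_simps)
    then show "inv\<^bsub>add_monoid class_ring\<^esub> a \<in> I" by (simp only: a_inv_def)
  qed (use assms in auto)
  then show "subgroup I (add_monoid (class_ring :: 'a ring))" .
qed (use assms in \<open>auto simp: mult.commute\<close>)

lemma class_ring_idealD:
  fixes I :: "'a::comm_ring_1 set"
  assumes "ideal I class_ring"
  shows "0 \<in> I" "a \<in> I \<Longrightarrow> b \<in> I \<Longrightarrow> a + b \<in> I" "a \<in> I \<Longrightarrow> s * a \<in> I" "a \<in> I \<Longrightarrow> b \<in> I \<Longrightarrow> a - b \<in> I"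
proof -
  interpret ideal I "class_ring :: 'a ring" by fact
  show "0 \<in> I" using zero_closed by simp
  show m: "a \<in> I \<Longrightarrow> s * a \<in> I" for a s using I_l_closed[of a s] by simp
  show p: "a \<in> I \<Longrightarrow> b \<in> I \<Longrightarrow> a + b \<in> I" for a b using a_closed[of a b] by simp
  show "a \<in> I \<Longrightarrow> b \<in> I \<Longrightarrow> a - b \<in> I" using p[of a "(-1) * b"] m[of b "-1"] by simp
qed

lemma class_ring_primeidealI:
  fixes I :: "'a::comm_ring_1 set"
  assumes "ideal I class_ring" "I \<noteq> UNIV" "\<And>a b. a * b \<in> I \<Longrightarrow> a \<in> I \<or> b \<in> I"
  shows "primeideal I class_ring"
  using assms by (intro primeidealI) (auto intro: class_cring.cring_axioms)

lemma ideal_adjoin: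
  fixes P :: "'a::comm_ring_1 set"
  assumes "ideal P class_ring"
  shows "ideal {p + s * a | p s. p \<in> P} class_ring"
proof (rule class_ring_idealI)
  show "0 \<in> {p + s * a | p s. p \<in> P}"
    using class_ring_idealD(1)[OF assms] by (auto intro!: exI[of _ 0])
next
  fix u v assume "u \<in> {p + s * a | p s. p \<in> P}" "v \<in> {p + s * a | p s. p \<in> P}"
  then obtain p s q t where "u = p + s * a" "v = q + t * a" "p \<in> P" "q \<in> P" by blast
  then show "u + v \<in> {p + s * a | p s. p \<in> P}"
    using class_ring_idealD(2)[OF assms, of p q]
    by (intro CollectI exI[of _ "p + q"] exI[of _ "s + t"]) (simp add: algebra_simps)
next
  fix u r assume "u \<in> {p + s * a | p s. p \<in> P}"
  then obtain p s where "u = p + s * a" "p \<in> P" by blast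
  then show "r * u \<in> {p + s * a | p s. p \<in> P}"
    using class_ring_idealD(3)[OF assms, of p r]
    by (intro CollectI exI[of _ "r * p"] exI[of _ "r * s"]) (simp add: algebra_simps)
qed

lemma subset_adjoin: "P \<subseteq> {p + s * a | p s. p \<in> P}" for a :: "'a::comm_ring_1"
proof
  fix p assume "p \<in> P"
  then show "p \<in> {p + s * a | p s. p \<in> P}" by (intro CollectI exI[of _ p] exI[of _ 0]) simp
qed

lemma mem_adjoin:
  fixes a :: "'a::comm_ring_1"
  assumes "ideal P class_ring"
  shows "a \<in> {p + s * a | p s. p \<in> P}"
  using class_ring_idealD(1)[OF assms] by (intro CollectI exI[of _ 0] exI[of _ 1]) simp

text \<open>Zorn's lemma gives an ideal \<open>P\<close> maximal among those containing
  \<open>J\<close> and missing \<open>T\<close>. For \<open>a\<close> and \<open>b\<close> outside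
  \<open>P\<close>, adjoining either one meets \<open>T\<close>; the product of the two witnesses is
  in \<open>T\<close>, and it would be in \<open>P\<close> if \<open>a * b\<close> were.\<close>

lemma exists_prime_avoiding:
  fixes J :: "'a::comm_ring_1 set"
  assumes J: "ideal J class_ring" and avoid: "J \<inter> T = {}"
    and one: "1 \<in> T" and mult: "\<And>s t. s \<in> T \<Longrightarrow> t \<in> T \<Longrightarrow> s * t \<in> T"
  shows "\<exists>P. primeideal P class_ring \<and> J \<subseteq> P \<and> P \<inter> T = {}"
proof -
  let ?A = "{P. ideal P (class_ring :: 'a ring) \<and> J \<subseteq> P \<and> P \<inter> T = {}}"
  have "\<exists>M\<in>?A. \<forall>X\<in>?A. M \<subseteq> X \<longrightarrow> X = M"
  proof (rule subset_Zorn_nonempty)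
    show "?A \<noteq> {}" using J avoid by blast
    fix C assume C: "C \<noteq> {}" "subset.chain ?A C"
    then have CA: "C \<subseteq> ?A" and lin: "\<And>X Y. X \<in> C \<Longrightarrow> Y \<in> C \<Longrightarrow> X \<subseteq> Y \<or> Y \<subseteq> X"
      by (auto simp: subset_chain_def)
    have "ideal (\<Union>C) (class_ring :: 'a ring)"
    proof (rule class_ring_idealI)
      show "0 \<in> \<Union>C" using C(1) CA class_ring_idealD(1) by fastforce
      show "s * a \<in> \<Union>C" if "a \<in> \<Union>C" for a s
        using that CA class_ring_idealD(3) by fastforce
      fix a b assume "a \<in> \<Union>C" "b \<in> \<Union>C"
      then obtain X Y where "X \<in> C" "Y \<in> C" "a \<in> X" "b \<in> Y" by blast
      then obtain Z where "Z \<in> C" "a \<in> Z" "b \<in> Z" using lin by blast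
      then show "a + b \<in> \<Union>C" using CA class_ring_idealD(2)[of Z a b] by blast
    qed
    then show "\<Union>C \<in> ?A" using C(1) CA by blast
  qed
  then obtain P where PA: "P \<in> ?A" and maxA: "\<forall>X\<in>?A. P \<subseteq> X \<longrightarrow> X = P" by (rule bexE)
  have P: "ideal P class_ring" "J \<subseteq> P" "P \<inter> T = {}" using PA by simp_all
  have max: "X = P" if "ideal X class_ring" "J \<subseteq> X" "X \<inter> T = {}" "P \<subseteq> X" for X
    using maxA that by simp
  have meet: "\<exists>p\<in>P. \<exists>s. p + s * a \<in> T" if "a \<notin> P" for a
  proof (rule ccontr)
    assume neg: "\<not> ?thesis"
    let ?X = "{p + s * a | p s. p \<in> P}"
    have id: "ideal ?X class_ring" by (rule ideal_adjoin[OF P(1)])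
    have sub: "P \<subseteq> ?X" by (rule subset_adjoin)
    have "a \<in> ?X" by (rule mem_adjoin[OF P(1)])
    moreover have "?X = P" by (rule max) (use id sub P(2) neg in auto)
    ultimately show False using that by blast
  qed
  have "primeideal P class_ring"
  proof (rule class_ring_primeidealI)
    show "ideal P class_ring" by fact
    show "P \<noteq> UNIV" using P(3) one by blast
    fix a b assume ab: "a * b \<in> P"
    show "a \<in> P \<or> b \<in> P"
    proof (rule ccontr)
      assume "\<not> ?thesis"
      then have "a \<notin> P" "b \<notin> P" by auto
      obtain p s where p: "p \<in> P" "p + s * a \<in> T" using meet[OF \<open>a \<notin> P\<close>] by blast
      obtain q t where q: "q \<in> P" "q + t * b \<in> T" using meet[OF \<open>b \<notin> P\<close>] by blast
      have "(p + s * a) * (q + t * b) = (q + t * b) * p + (s * a) * q + (s * t) * (a * b)"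
        by (simp add: algebra_simps)
      moreover have "\<dots> \<in> P"
        by (intro class_ring_idealD(2,3)[OF P(1)] p(1) q(1) ab)
      ultimately show False using mult[OF p(2) q(2)] P(3) by auto
    qed
  qed
  then show ?thesis using P by blast
qed

text \<open>The prime is chosen to miss the multiplicative set of polynomials with leading monomial
  in \<open>U\<close>, so it inherits the hypothesis on \<open>J\<close> and can serve as the next
  link of a chain.\<close>

lemma prime_avoiding_leads:
  fixes J :: "('n::finite, 'k::field) mpoly set"
  assumes "inj \<iota>" "ideal J class_ring"
    and "\<And>f \<mu>. f \<in> J \<Longrightarrow> is_lead \<iota> f \<mu> \<Longrightarrow> \<not> Poly_Mapping.keys \<mu> \<subseteq> U"
  shows "\<exists>P. primeideal P class_ring \<and> J \<subseteq> P \<and>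
    (\<forall>f\<in>P. \<forall>\<mu>. is_lead \<iota> f \<mu> \<longrightarrow> \<not> Poly_Mapping.keys \<mu> \<subseteq> U)"
proof -
  let ?T = "{f :: ('n, 'k) mpoly. \<exists>\<mu>. is_lead \<iota> f \<mu> \<and> Poly_Mapping.keys \<mu> \<subseteq> U}"
  have "\<exists>P. primeideal P class_ring \<and> J \<subseteq> P \<and> P \<inter> ?T = {}"
  proof (rule exists_prime_avoiding[OF assms(2)])
    show "J \<inter> ?T = {}" using assms(3) by blast
    show "1 \<in> ?T" by (auto simp: is_lead_def intro!: exI[of _ 0])
    fix s t assume "s \<in> ?T" "t \<in> ?T"
    then obtain \<mu> \<nu> where "is_lead \<iota> s \<mu>" "Poly_Mapping.keys \<mu> \<subseteq> U" "is_lead \<iota> t \<nu>" "Poly_Mapping.keys \<nu> \<subseteq> U"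
      by blast
    then show "s * t \<in> ?T"
      using is_lead_mult[OF assms(1), of s \<mu> t \<nu>] keys_add[of \<mu> \<nu>] by blast
  qed
  then show ?thesis by blast
qed

text \<open>
  If \<open>x\<close> is the variable of \<open>U\<close> of least index, then every multiple of \<open>x\<close> has only monomials that are
  larger than every monomial in \<open>U - {x}\<close>. So adjoining \<open>x\<close> to an ideal without leading monomials in
  \<open>U\<close> creates no leading monomial in \<open>U - {x}\<close>, and the chain can be built one variable at a time.
\<close>

lemma prime_chain_of_independent:
  fixes J :: "('n::finite, 'k::field) mpoly set"
  assumes inj: "inj \<iota>" and "ideal J class_ring"
    and "\<And>f \<mu>. f \<in> J \<Longrightarrow> is_lead \<iota> f \<mu> \<Longrightarrow> \<not> Poly_Mapping.keys \<mu> \<subseteq> U"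
  shows "\<exists>P. (\<forall>i\<le>card U. primeideal (P i) class_ring \<and> J \<subseteq> P i) \<and> (\<forall>i<card U. P i \<subset> P (Suc i))"
  using assms(2,3)
proof (induction "card U" arbitrary: U J)
  case (0 U J)
  obtain P where "primeideal P class_ring" "J \<subseteq> P"
    using prime_avoiding_leads[OF inj 0(2), of U] 0(3) by blast
  then show ?case using 0(1) by (intro exI[of _ "\<lambda>_. P"]) auto
next
  case (Suc c U J)
  obtain P where P: "primeideal P class_ring" "J \<subseteq> P"
    "\<And>f \<mu>. f \<in> P \<Longrightarrow> is_lead \<iota> f \<mu> \<Longrightarrow> \<not> Poly_Mapping.keys \<mu> \<subseteq> U"
    using prime_avoiding_leads[OF inj Suc(3), of U] Suc(4) by blast
  have "U \<noteq> {}" using Suc(2) by auto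
  then obtain x where x: "x \<in> U" "\<And>y. y \<in> U \<Longrightarrow> \<iota> x \<le> \<iota> y"
    by (metis arg_min_if_finite(1) arg_min_least finite)
  let ?X = "Poly_Mapping.single (Poly_Mapping.single x 1) 1 :: ('n, 'k) mpoly"
  let ?Q = "{p + s * ?X | p s. p \<in> P}"
  have idP: "ideal P class_ring" using P(1) primeideal.axioms(1) by blast
  have idQ: "ideal ?Q class_ring" by (rule ideal_adjoin[OF idP])
  have PQ: "P \<subseteq> ?Q" by (rule subset_adjoin)
  have XQ: "?X \<in> ?Q" by (rule mem_adjoin[OF idP])
  \<comment> \<open>The variable is its own leading monomial and lies in \<open>U\<close>; this
    makes the first inclusion of the chain strict.\<close>
  have XP: "?X \<notin> P" using P(3)[of ?X "Poly_Mapping.single x 1"] x(1) by (auto simp: is_lead_def)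
  have "\<not> Poly_Mapping.keys \<mu> \<subseteq> U - {x}" if fQ: "f \<in> ?Q" and lead: "is_lead \<iota> f \<mu>" for f \<mu>
  proof
    assume k: "Poly_Mapping.keys \<mu> \<subseteq> U - {x}"
    obtain p s where p: "p \<in> P" "f = p + s * ?X" using fQ by blast
    have less: "lexkey \<iota> \<mu> < lexkey \<iota> \<nu>" if "\<nu> \<in> Poly_Mapping.keys (s * ?X)" for \<nu>
    proof (rule lexkey_less_of_variable[OF inj])
      show "\<iota> x < \<iota> y" if "y \<in> Poly_Mapping.keys \<mu>" for y
        using that k x(2)[of y] inj by (metis Diff_iff inj_eq insertI1 nless_le subsetD)
      show "Poly_Mapping.lookup \<nu> x > 0"
        using that keys_mult[of s ?X] by (auto simp: lookup_add)
    qed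
    then have "\<mu> \<notin> Poly_Mapping.keys (s * ?X)" by blast
    then have 1: "\<mu> \<in> Poly_Mapping.keys p"
      using lead p(2) by (auto simp: is_lead_def in_keys_iff lookup_add)
    \<comment> \<open>Monomials of \<open>p\<close> occur in \<open>f\<close> or in
      \<open>s * ?X\<close>, and in both all those other than \<open>\<mu>\<close> are larger. So
      \<open>\<mu>\<close> would lead \<open>p\<close>, against the choice of
      \<open>P\<close>.\<close>
    have "Poly_Mapping.keys p \<subseteq> Poly_Mapping.keys f \<union> Poly_Mapping.keys (s * ?X)"
      using p(2) by (auto simp: in_keys_iff lookup_add)
    then have "is_lead \<iota> p \<mu>" using lead less 1 unfolding is_lead_def by blast
    then show False using P(3)[OF p(1)] k by blast
  qed
  moreover have "c = card (U - {x})" using Suc(2) x(1) by simp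
  ultimately have "\<exists>P'. (\<forall>i\<le>c. primeideal (P' i) class_ring \<and> ?Q \<subseteq> P' i)
      \<and> (\<forall>i<c. P' i \<subset> P' (Suc i))"
    using Suc(1)[of "U - {x}" ?Q, OF _ idQ] by simp
  then obtain P' where P': "\<forall>i\<le>c. primeideal (P' i) class_ring \<and> ?Q \<subseteq> P' i"
    "\<forall>i<c. P' i \<subset> P' (Suc i)"
    by blast
  have "P \<subset> P' 0" using P'(1) PQ XQ XP by blast
  have JP': "J \<subseteq> P' j" if "j \<le> c" for j
    using P'(1) that P(2) PQ by (meson subset_trans)
  show ?case
  proof (intro exI[of _ "\<lambda>i. case i of 0 \<Rightarrow> P | Suc j \<Rightarrow> P' j"] conjI allI impI)
    fix i assume i: "i \<le> card U"
    show "primeideal (case i of 0 \<Rightarrow> P | Suc j \<Rightarrow> P' j) class_ring"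
      using P(1) P'(1) i Suc(2) by (cases i) simp_all
    show "J \<subseteq> (case i of 0 \<Rightarrow> P | Suc j \<Rightarrow> P' j)"
      using P(2) JP' i Suc(2) by (cases i) simp_all
  next
    fix i assume i: "i < card U"
    show "(case i of 0 \<Rightarrow> P | Suc j \<Rightarrow> P' j) \<subset> (case Suc i of 0 \<Rightarrow> P | Suc j \<Rightarrow> P' j)"
      using \<open>P \<subset> P' 0\<close> P'(2) i Suc(2) by (cases i) simp_all
  qed
qed

subsection \<open>Counting monomials\<close>

lemma lookup_le_monom_degree: "Poly_Mapping.lookup \<mu> x \<le> monom_degree \<mu>"
  unfolding monom_degree_def by (rule member_le_sum) simp_all

text \<open>As a product of exponent sets, a box has a generating function that factors over the
  variables.\<close>

definition box :: "('n::finite \<Rightarrow> nat set) \<Rightarrow> ('n \<Rightarrow>\<^sub>0 nat) set" where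
  "box D = {\<mu>. \<forall>x. Poly_Mapping.lookup \<mu> x \<in> D x}"

lemma bij_betw_box: "bij_betw Poly_Mapping.lookup (box D) (PiE UNIV (D :: 'n::finite \<Rightarrow> nat set))"
proof (rule bij_betw_byWitness[where f' = Abs_poly_mapping])
  show "\<forall>\<mu>\<in>box D. Abs_poly_mapping (Poly_Mapping.lookup \<mu>) = \<mu>"
    by (simp add: Poly_Mapping.lookup_inverse)
  show "\<forall>g\<in>PiE UNIV D. Poly_Mapping.lookup (Abs_poly_mapping g) = g"
    by (simp add: lookup_Abs_poly_mapping)
  show "Poly_Mapping.lookup ` box D \<subseteq> PiE UNIV D" by (auto simp: box_def)
  show "Abs_poly_mapping ` PiE UNIV D \<subseteq> box D"
    by (auto simp: box_def lookup_Abs_poly_mapping)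
qed

lemma finite_box:
  assumes "\<And>x. finite (D x)"
  shows "finite (box (D :: 'n::finite \<Rightarrow> nat set))"
  using bij_betw_finite[OF bij_betw_box, of D] finite_PiE[of UNIV D] assms by simp

lemma sum_box:
  fixes D :: "'n::finite \<Rightarrow> nat set" and t :: real
  assumes "\<And>x. finite (D x)"
  shows "(\<Sum>\<mu>\<in>box D. t ^ monom_degree \<mu>) = (\<Prod>x\<in>UNIV. \<Sum>j\<in>D x. t ^ j)"
proof -
  have "(\<Sum>\<mu>\<in>box D. t ^ monom_degree \<mu>) = (\<Sum>\<mu>\<in>box D. \<Prod>x\<in>UNIV. t ^ Poly_Mapping.lookup \<mu> x)"
    by (simp add: monom_degree_def power_sum)
  also have "\<dots> = (\<Sum>g\<in>PiE UNIV D. \<Prod>x\<in>UNIV. t ^ g x)"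
    by (rule sum.reindex_bij_betw[OF bij_betw_box])
  also have "\<dots> = (\<Prod>x\<in>UNIV. \<Sum>j\<in>D x. t ^ j)"
    by (rule prod_sum_PiE[symmetric]) (simp_all add: assms)
  finally show ?thesis .
qed

lemma sum_power_le:
  fixes t :: real
  assumes "0 < t" "t < 1" "finite A"
  shows "(\<Sum>j\<in>A. t ^ j) \<le> 1 / (1 - t)"
  using sum_le_suminf[of "\<lambda>j. t ^ j" A] assms by (simp add: suminf_geometric summable_geometric)

text \<open>
  Beyond a common bound \<open>N\<close> on the exponents of the monomials \<open>l\<close>, a monomial in \<open>B\<close> can have at most
  \<open>\<delta>\<close> large exponents. Each free exponent contributes a factor \<open>1 / (1 - t)\<close>.
\<close>

lemma growth_of_standard_monomials:
  fixes B :: "('n::finite \<Rightarrow>\<^sub>0 nat) set"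
  assumes "\<And>U. card U = Suc \<delta> \<Longrightarrow> \<exists>l. Poly_Mapping.keys l \<subseteq> U \<and>
      (\<forall>\<mu>\<in>B. \<exists>x. Poly_Mapping.lookup \<mu> x < Poly_Mapping.lookup l x)"
  shows "\<exists>C\<ge>0. \<forall>t A. 0 < t \<longrightarrow> t < (1::real) \<longrightarrow> finite A \<longrightarrow> A \<subseteq> B \<longrightarrow>
      (\<Sum>\<mu>\<in>A. t ^ monom_degree \<mu>) \<le> C / (1 - t) ^ \<delta>"
proof -
  let ?n = "CARD('n)"
  obtain l where l: "\<And>U. card U = Suc \<delta> \<Longrightarrow> Poly_Mapping.keys (l U) \<subseteq> U"
    "\<And>U \<mu>. card U = Suc \<delta> \<Longrightarrow> \<mu> \<in> B \<Longrightarrow>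
        \<exists>x. Poly_Mapping.lookup \<mu> x < Poly_Mapping.lookup (l U) x"
    using assms by metis
  \<comment> \<open>The sum over all \<open>U\<close>, including those where \<open>l U\<close> is
    arbitrary, dominates every exponent that occurs. \<open>Suc\<close> ensures
    \<open>1 \<le> N\<close>, so a factor \<open>N\<close> may be granted to every variable.\<close>
  define N where "N = Suc (\<Sum>U\<in>UNIV. \<Sum>x\<in>UNIV. Poly_Mapping.lookup (l U) x)"
  have lN: "Poly_Mapping.lookup (l U) x \<le> N" for U x
  proof -
    have "Poly_Mapping.lookup (l U) x \<le> (\<Sum>x\<in>UNIV. Poly_Mapping.lookup (l U) x)"
      by (rule member_le_sum) simp_all
    also have "\<dots> \<le> (\<Sum>U\<in>UNIV. \<Sum>x\<in>UNIV. Poly_Mapping.lookup (l U) x)"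
      by (rule member_le_sum) simp_all
    finally show ?thesis by (simp add: N_def)
  qed
  define big where "big \<mu> = {x. N \<le> Poly_Mapping.lookup \<mu> x}" for \<mu> :: "'n \<Rightarrow>\<^sub>0 nat"
  have card_big: "card (big \<mu>) \<le> \<delta>" if mu: "\<mu> \<in> B" for \<mu>
  proof (rule ccontr)
    assume "\<not> ?thesis"
    \<comment> \<open>If more than \<open>\<delta>\<close> exponents were large, \<open>l U\<close>
      for a set \<open>U\<close> of \<open>\<delta> + 1\<close> of them would divide
      \<open>\<mu>\<close>.\<close>
    then obtain U where U: "U \<subseteq> big \<mu>" "card U = Suc \<delta>"
      using obtain_subset_with_card_n[of "Suc \<delta>" "big \<mu>"] by auto
    obtain x where x: "Poly_Mapping.lookup \<mu> x < Poly_Mapping.lookup (l U) x"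
      using l(2)[OF U(2) mu] by blast
    then have "x \<in> U" using l(1)[OF U(2)] by (auto simp: in_keys_iff)
    then have "N \<le> Poly_Mapping.lookup \<mu> x" using U(1) by (auto simp: big_def)
    then show False using x lN[of U x] by simp
  qed
  have "1 \<le> N" by (simp add: N_def)
  then have N1: "real N \<ge> 1" by linarith
  have "(\<Sum>\<mu>\<in>A. t ^ monom_degree \<mu>) \<le> (2 ^ ?n * real N ^ ?n) / (1 - t) ^ \<delta>"
    if t: "0 < t" "t < 1" and A: "finite A" "A \<subseteq> B" for t :: real and A
  proof -
    \<comment> \<open>This cuts the large exponents off above the finite set \<open>A\<close>, so
      that boxes are finite; the final estimate does not depend on it.\<close>
    define M where "M = Suc (\<Sum>\<mu>\<in>A. monom_degree \<mu>)"
    have M: "Poly_Mapping.lookup \<mu> x < M" if "\<mu> \<in> A" for \<mu> x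
    proof -
      have "Poly_Mapping.lookup \<mu> x \<le> monom_degree \<mu>" by (rule lookup_le_monom_degree)
      also have "\<dots> \<le> (\<Sum>\<mu>\<in>A. monom_degree \<mu>)" by (rule member_le_sum) (use that A in simp_all)
      finally show ?thesis by (simp add: M_def)
    qed
    have t1: "1 / (1 - t) \<ge> 1" using t by simp
    \<comment> \<open>Monomials are sorted by the set \<open>V\<close> of their large exponents,
      which causes the factor \<open>2 ^ ?n\<close> in the constant. Variables in \<open>V\<close>
      give at most \<open>N / (1 - t)\<close>, the others at most \<open>N\<close>.\<close>
    have part: "(\<Sum>\<mu>\<in>{\<mu>\<in>A. big \<mu> = V}. t ^ monom_degree \<mu>) \<le> real N ^ ?n / (1 - t) ^ \<delta>" for V
    proof (cases "card V \<le> \<delta>")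
      case True
      let ?D = "\<lambda>x. if x \<in> V then {..<M} else {..<N}"
      have "(\<Sum>\<mu>\<in>{\<mu>\<in>A. big \<mu> = V}. t ^ monom_degree \<mu>) \<le> (\<Sum>\<mu>\<in>box ?D. t ^ monom_degree \<mu>)"
      proof (rule sum_mono2)
        show "finite (box ?D)" by (rule finite_box) simp
        show "{\<mu>\<in>A. big \<mu> = V} \<subseteq> box ?D" using M by (auto simp: box_def big_def not_le)
      qed (use t in simp)
      also have "\<dots> = (\<Prod>x\<in>UNIV. \<Sum>j\<in>?D x. t ^ j)" by (rule sum_box) simp
      also have "\<dots> \<le> (\<Prod>x\<in>UNIV. real N * (if x \<in> V then 1 / (1 - t) else 1))"
      proof (rule prod_mono, intro conjI)
        fix x :: 'n
        show "0 \<le> (\<Sum>j\<in>?D x. t ^ j)" by (rule sum_nonneg) (use t in auto)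
        show "(\<Sum>j\<in>?D x. t ^ j) \<le> real N * (if x \<in> V then 1 / (1 - t) else 1)"
        proof (cases "x \<in> V")
          case True
          have "(\<Sum>j<M. t ^ j) \<le> 1 * (1 / (1 - t))" using sum_power_le[OF t] by simp
          also have "\<dots> \<le> real N * (1 / (1 - t))" by (rule mult_right_mono) (use N1 t in auto)
          finally show ?thesis using True by simp
        next
          case False
          have "(\<Sum>j<N. t ^ j) \<le> (\<Sum>j<N. 1)" by (rule sum_mono) (use t in \<open>simp add: power_le_one\<close>)
          then show ?thesis using False by simp
        qed
      qed
      also have "\<dots> = real N ^ ?n * (1 / (1 - t)) ^ card V"
        by (simp add: prod.distrib prod.If_cases)
      also have "\<dots> \<le> real N ^ ?n * (1 / (1 - t)) ^ \<delta>"
        by (rule mult_left_mono[OF power_increasing[OF True t1]]) simp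
      finally show ?thesis by (simp add: power_divide)
    next
      case False
      then have "{\<mu>\<in>A. big \<mu> = V} = {}" using card_big A by auto
      then show ?thesis using t by (simp only: sum.empty) simp
    qed
    have "(\<Sum>\<mu>\<in>A. t ^ monom_degree \<mu>)
        = (\<Sum>V\<in>UNIV. \<Sum>\<mu>\<in>{\<mu>\<in>A. big \<mu> = V}. t ^ monom_degree \<mu>)"
      by (rule sum.group[symmetric]) (use A in auto)
    also have "\<dots> \<le> (\<Sum>V\<in>(UNIV :: 'n set set). real N ^ ?n / (1 - t) ^ \<delta>)"
      by (rule sum_mono) (rule part)
    finally show ?thesis by (simp add: card_UNIV_set)
  qed
  then show ?thesis by (intro exI[of _ "2 ^ ?n * real N ^ ?n"]) auto
qed

section \<open>Hilbert series as real power series\<close>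

definition monoms_of_degree :: "nat \<Rightarrow> ('n::finite \<Rightarrow>\<^sub>0 nat) set" where
  "monoms_of_degree m = {\<mu>. monom_degree \<mu> = m}"

lemma finite_monoms_of_degree: "finite (monoms_of_degree m :: ('n::finite \<Rightarrow>\<^sub>0 nat) set)"
proof (rule finite_subset)
  show "monoms_of_degree m \<subseteq> box (\<lambda>_::'n. {..m})"
    using lookup_le_monom_degree by (auto simp: monoms_of_degree_def box_def)
qed (simp add: finite_box)

lemma sum_by_degree:
  fixes t :: real
  shows "(\<Sum>m<k. real (card (B \<inter> monoms_of_degree m)) * t ^ m)
    = (\<Sum>\<mu>\<in>B \<inter> {\<mu> :: 'n::finite \<Rightarrow>\<^sub>0 nat. monom_degree \<mu> < k}. t ^ monom_degree \<mu>)"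
    and "finite {\<mu> :: 'n \<Rightarrow>\<^sub>0 nat. monom_degree \<mu> < k}"
proof -
  have *: "{\<mu> :: 'n \<Rightarrow>\<^sub>0 nat. monom_degree \<mu> < k} = (\<Union>m<k. monoms_of_degree m)"
    by (auto simp: monoms_of_degree_def)
  then show fin: "finite {\<mu> :: 'n \<Rightarrow>\<^sub>0 nat. monom_degree \<mu> < k}"
    using finite_monoms_of_degree by auto
  let ?S = "B \<inter> {\<mu> :: 'n \<Rightarrow>\<^sub>0 nat. monom_degree \<mu> < k}"
  have "(\<Sum>\<mu>\<in>?S. t ^ monom_degree \<mu>)
      = (\<Sum>m<k. \<Sum>\<mu>\<in>{\<mu>\<in>?S. monom_degree \<mu> = m}. t ^ monom_degree \<mu>)"
    by (rule sum.group[symmetric]) (use fin in auto)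
  also have "\<dots> = (\<Sum>m<k. real (card (B \<inter> monoms_of_degree m)) * t ^ m)"
  proof (rule sum.cong[OF refl])
    fix m assume "m \<in> {..<k}"
    then have "{\<mu>\<in>?S. monom_degree \<mu> = m} = B \<inter> monoms_of_degree m"
      by (auto simp: monoms_of_degree_def)
    then show "(\<Sum>\<mu>\<in>{\<mu>\<in>?S. monom_degree \<mu> = m}. t ^ monom_degree \<mu>)
        = real (card (B \<inter> monoms_of_degree m)) * t ^ m"
      by (simp add: monoms_of_degree_def)
  qed
  finally show "(\<Sum>m<k. real (card (B \<inter> monoms_of_degree m)) * t ^ m)
    = (\<Sum>\<mu>\<in>?S. t ^ monom_degree \<mu>)" by simp
qed

lemma hilbert_series_summable:
  fixes t :: real and B :: "('n::finite \<Rightarrow>\<^sub>0 nat) set"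
  assumes "0 < t"
    and "\<And>A. finite A \<Longrightarrow> A \<subseteq> B \<Longrightarrow> (\<Sum>\<mu>\<in>A. t ^ monom_degree \<mu>) \<le> c"
  shows "summable (\<lambda>m. real (card (B \<inter> monoms_of_degree m)) * t ^ m)"
    and "suminf (\<lambda>m. real (card (B \<inter> monoms_of_degree m)) * t ^ m) \<le> c"
proof -
  have bd: "(\<Sum>m<k. real (card (B \<inter> monoms_of_degree m)) * t ^ m) \<le> c" for k
    unfolding sum_by_degree(1) by (rule assms(2)) (auto intro: finite_subset[OF _ sum_by_degree(2)[of k]])
  show s: "summable (\<lambda>m. real (card (B \<inter> monoms_of_degree m)) * t ^ m)"
  proof (rule bounded_imp_summable)
    show "(\<Sum>m\<le>k. real (card (B \<inter> monoms_of_degree m)) * t ^ m) \<le> c" for k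
      using bd[of "Suc k"] by (simp add: lessThan_Suc_atMost)
  qed (use assms(1) in simp)
  show "suminf (\<lambda>m. real (card (B \<inter> monoms_of_degree m)) * t ^ m) \<le> c"
    by (rule suminf_le_const[OF s bd])
qed

text \<open>The power of a truncated geometric sum counts the monomials of a box, which are bounded
  in degree; the lower bound is the limit of growing boxes.\<close>

lemma hilbert_series_polynomial_ring:
  fixes t :: real
  assumes t: "0 < t" "t < 1"
  shows "summable (\<lambda>m. real (card (monoms_of_degree m :: ('n::finite \<Rightarrow>\<^sub>0 nat) set)) * t ^ m)"
    and "1 / (1 - t) ^ CARD('n) \<le> suminf (\<lambda>m. real (card (monoms_of_degree m :: ('n \<Rightarrow>\<^sub>0 nat) set)) * t ^ m)"
proof -
  let ?h = "\<lambda>m. real (card (monoms_of_degree m :: ('n \<Rightarrow>\<^sub>0 nat) set))"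
  let ?n = "CARD('n)"
  have "\<exists>C\<ge>0. \<forall>t A. 0 < t \<longrightarrow> t < (1::real) \<longrightarrow> finite A \<longrightarrow> A \<subseteq> (UNIV :: ('n \<Rightarrow>\<^sub>0 nat) set) \<longrightarrow>
      (\<Sum>\<mu>\<in>A. t ^ monom_degree \<mu>) \<le> C / (1 - t) ^ ?n"
  proof (rule growth_of_standard_monomials)
    \<comment> \<open>Vacuous: there are only \<open>?n\<close> variables.\<close>
    fix U :: "'n set" assume "card U = Suc ?n"
    then show "\<exists>l. Poly_Mapping.keys l \<subseteq> U \<and>
      (\<forall>\<mu>\<in>UNIV. \<exists>x. Poly_Mapping.lookup \<mu> x < Poly_Mapping.lookup l x)"
      using card_mono[of UNIV U] by simp
  qed
  then obtain C where C: "\<And>A. finite A \<Longrightarrow> A \<subseteq> (UNIV :: ('n \<Rightarrow>\<^sub>0 nat) set) \<Longrightarrow>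
      (\<Sum>\<mu>\<in>A. t ^ monom_degree \<mu>) \<le> C / (1 - t) ^ ?n"
    using t by blast
  show s: "summable (\<lambda>m. ?h m * t ^ m)"
    using hilbert_series_summable(1)[of t UNIV, OF t(1) C] by simp
  have "(\<Sum>j<k. t ^ j) ^ ?n \<le> suminf (\<lambda>m. ?h m * t ^ m)" for k
  proof -
    have "(\<Sum>j<k. t ^ j) ^ ?n = (\<Sum>\<mu>\<in>box (\<lambda>_::'n. {..<k}). t ^ monom_degree \<mu>)"
      by (simp add: sum_box)
    also have "\<dots> \<le> (\<Sum>\<mu>\<in>UNIV \<inter> {\<mu> :: 'n \<Rightarrow>\<^sub>0 nat. monom_degree \<mu> < Suc (?n * k)}. t ^ monom_degree \<mu>)"
    proof (rule sum_mono2)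
      show "box (\<lambda>_::'n. {..<k}) \<subseteq> UNIV \<inter> {\<mu>. monom_degree \<mu> < Suc (?n * k)}"
      proof
        fix \<mu> assume "\<mu> \<in> box (\<lambda>_::'n. {..<k})"
        then have "monom_degree \<mu> \<le> (\<Sum>x\<in>(UNIV :: 'n set). k)"
          unfolding monom_degree_def by (intro sum_mono) (auto simp: box_def less_imp_le)
        then show "\<mu> \<in> UNIV \<inter> {\<mu>. monom_degree \<mu> < Suc (?n * k)}" by simp
      qed
    qed (use t sum_by_degree(2) in auto)
    also have "\<dots> = (\<Sum>m<Suc (?n * k). ?h m * t ^ m)"
      unfolding sum_by_degree(1)[symmetric] by simp
    also have "\<dots> \<le> suminf (\<lambda>m. ?h m * t ^ m)"
      by (rule sum_le_suminf[OF s]) (use t in auto)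
    finally show ?thesis .
  qed
  moreover have "(\<lambda>k. (\<Sum>j<k. t ^ j) ^ ?n) \<longlonglongrightarrow> (1 / (1 - t)) ^ ?n"
    using geometric_sums[of t] t by (intro tendsto_power) (simp add: sums_def)
  ultimately show "1 / (1 - t) ^ ?n \<le> suminf (\<lambda>m. ?h m * t ^ m)"
    by (intro LIMSEQ_le_const2[of "\<lambda>k. (\<Sum>j<k. t ^ j) ^ ?n"]) (auto simp: power_divide)
qed

subsection \<open>Uniqueness of the Betti numbers\<close>

lemma lookup_mult_zero:
  fixes f g :: "('n::finite, 'k::field) mpoly"
  shows "Poly_Mapping.lookup (f * g) 0 = Poly_Mapping.lookup f 0 * Poly_Mapping.lookup g 0"
proof -
  have z: "\<alpha> = 0 \<and> \<beta> = 0" if "\<alpha> + \<beta> = 0" for \<alpha> \<beta> :: "'n \<Rightarrow>\<^sub>0 nat"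
  proof -
    have "Poly_Mapping.lookup \<alpha> x + Poly_Mapping.lookup \<beta> x = 0" for x
      using that by (metis lookup_add lookup_zero)
    then show ?thesis by (auto intro!: poly_mapping_eqI)
  qed
  have "Poly_Mapping.lookup (f * g) (0 + 0) = Poly_Mapping.lookup f 0 * Poly_Mapping.lookup g 0"
    by (rule lookup_mult_extreme) (drule z[OF trans[OF _ add_0_left]], assumption)
  then show ?thesis by simp
qed

text \<open>Reduction modulo the variables, applied entrywise to matrices below.\<close>

interpretation const_term: comm_ring_hom "\<lambda>f :: ('n::finite, 'k::field) mpoly. Poly_Mapping.lookup f 0"
  by unfold_locales (simp_all add: lookup_add lookup_mult_zero)

text \<open>A map out of a free module can be lifted one basis vector at a time.\<close>

lemma mat_factor_through:
  fixes A :: "'a::comm_ring_1 mat"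
  assumes A: "A \<in> carrier_mat a b" and B: "B \<in> carrier_mat a c"
    and im: "\<And>j. j < c \<Longrightarrow> col B j \<in> mat_image A"
  shows "\<exists>X\<in>carrier_mat b c. A * X = B"
proof -
  have "\<exists>v. v \<in> carrier_vec b \<and> A *\<^sub>v v = col B j" if "j < c" for j
    using im[OF that] A by (auto simp: mat_image_def)
  then obtain v where v: "\<And>j. j < c \<Longrightarrow> v j \<in> carrier_vec b \<and> A *\<^sub>v v j = col B j"
    by metis
  define X where "X = mat b c (\<lambda>(i, j). v j $ i)"
  have X: "X \<in> carrier_mat b c" by (simp add: X_def)
  have colX: "col X j = v j" if "j < c" for j
    using v[OF that] that by (intro eq_vecI) (auto simp: X_def)
  have "A * X = B"
  proof (rule eq_matI)
    fix i j assume ij: "i < dim_row B" "j < dim_col B"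
    then have "(A * X) $$ (i, j) = (A *\<^sub>v col X j) $ i" using A B X by simp
    also have "\<dots> = B $$ (i, j)" using v colX ij B by simp
    finally show "(A * X) $$ (i, j) = B $$ (i, j)" .
  qed (use A B X in auto)
  then show ?thesis using X by blast
qed

text \<open>If r < r', padding both matrices with zeros to size r' keeps the product. A one-sided
  inverse of a square matrix is two-sided, but row r of the padded \<open>U\<close> is zero.\<close>

lemma inverse_dim_le:
  fixes V U :: "'k::field mat"
  assumes V: "V \<in> carrier_mat r' r" and U: "U \<in> carrier_mat r r'" and VU: "V * U = 1\<^sub>m r'"
  shows "r' \<le> r"
proof (rule ccontr)
  assume "\<not> r' \<le> r"
  then have r: "r < r'" by simp
  define V' where "V' = mat r' r' (\<lambda>(i, j). if j < r then V $$ (i, j) else 0)"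
  define U' where "U' = mat r' r' (\<lambda>(i, j). if i < r then U $$ (i, j) else 0)"
  have c: "V' \<in> carrier_mat r' r'" "U' \<in> carrier_mat r' r'" by (simp_all add: V'_def U'_def)
  have "V' * U' = V * U"
  proof (rule eq_matI)
    fix i j assume "i < dim_row (V * U)" "j < dim_col (V * U)"
    then have ij: "i < r'" "j < r'" using V U by auto
    have "(V' * U') $$ (i, j) = (\<Sum>k<r'. if k < r then V $$ (i, k) * U $$ (k, j) else 0)"
      using ij by (auto simp: V'_def U'_def scalar_prod_def atLeast0LessThan intro!: sum.cong)
    also have "\<dots> = (\<Sum>k<r. V $$ (i, k) * U $$ (k, j))"
      using r by (simp add: sum.If_cases Int_def conj_commute) (intro sum.cong, auto)
    also have "\<dots> = (V * U) $$ (i, j)"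
      using ij V U by (simp add: scalar_prod_def atLeast0LessThan)
    finally show "(V' * U') $$ (i, j) = (V * U) $$ (i, j)" .
  qed (use V U in \<open>auto simp: V'_def U'_def\<close>)
  then have "U' * V' = 1\<^sub>m r'" using mat_mult_left_right_inverse[OF c] VU by simp
  moreover have "(U' * V') $$ (r, r) = 0"
    using r by (simp add: V'_def U'_def scalar_prod_def)
  ultimately show False using r by simp
qed

section \<open>Comparison of two minimal resolutions\<close>

lemma resolution_carrier:
  assumes "graded_free_resolution J r e A"
  shows "A (Suc i) \<in> carrier_mat (r i) (r (Suc i))"
  using assms by (simp add: graded_free_resolution_def)

lemma resolution_complex:
  assumes "graded_free_resolution J r e A"
  shows "A (Suc i) * A (Suc (Suc i)) = 0\<^sub>m (r i) (r (Suc (Suc i)))"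
proof -
  note c = resolution_carrier[OF assms]
  have ex: "mat_kernel (A (Suc i)) = mat_image (A (Suc (Suc i)))"
    using assms by (simp add: graded_free_resolution_def)
  have "(A (Suc i) * A (Suc (Suc i))) $$ (p, q) = 0" if "p < r i" "q < r (Suc (Suc i))" for p q
  proof -
    have "col (A (Suc (Suc i))) q = A (Suc (Suc i)) *\<^sub>v unit_vec (r (Suc (Suc i))) q"
      using c[of "Suc i"] that by (auto simp: mat_col_eqI intro!: eq_vecI)
    then have "col (A (Suc (Suc i))) q \<in> mat_kernel (A (Suc i))"
      unfolding ex mat_image_def using c[of "Suc i"] by auto
    then have "A (Suc i) *\<^sub>v col (A (Suc (Suc i))) q = 0\<^sub>v (r i)"
      using c[of i] by (simp add: mat_kernel_def)
    then have "(A (Suc i) *\<^sub>v col (A (Suc (Suc i))) q) $ p = 0" using that by simp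
    then show ?thesis using c[of i] c[of "Suc i"] that by simp
  qed
  then show ?thesis using c[of i] c[of "Suc i"] by (intro eq_matI) auto
qed

text \<open>Exactness applied to each column. Both the comparison maps and the homotopy are obtained
  from this.\<close>

lemma resolution_lift:
  assumes res: "graded_free_resolution J r e A"
    and X: "X \<in> carrier_mat (r (Suc i)) c" and zero: "A (Suc i) * X = 0\<^sub>m (r i) c"
  shows "\<exists>Y\<in>carrier_mat (r (Suc (Suc i))) c. A (Suc (Suc i)) * Y = X"
proof (rule mat_factor_through[OF resolution_carrier[OF res] X])
  fix j assume j: "j < c"
  have A: "A (Suc i) \<in> carrier_mat (r i) (r (Suc i))" by (rule resolution_carrier[OF res])
  have "A (Suc i) *\<^sub>v col X j = 0\<^sub>v (r i)"
  proof (rule eq_vecI)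
    fix p assume "p < dim_vec (0\<^sub>v (r i) :: ('a, 'b) mpoly vec)"
    then have p: "p < r i" by simp
    have "(A (Suc i) * X) $$ (p, j) = 0" using zero p j by simp
    then show "(A (Suc i) *\<^sub>v col X j) $ p = 0\<^sub>v (r i) $ p" using A X p j by simp
  qed (use A in auto)
  moreover have "mat_kernel (A (Suc i)) = mat_image (A (Suc (Suc i)))"
    using res by (simp add: graded_free_resolution_def)
  moreover have "col X j \<in> carrier_vec (r (Suc i))" using X j by auto
  ultimately show "col X j \<in> mat_image (A (Suc (Suc i)))"
    using mat_kernelI[OF A] by simp
qed

lemma minimal_const_term:
  assumes "minimal_graded_free_resolution J r e A"
  shows "map_mat (\<lambda>f. Poly_Mapping.lookup f 0) (A (Suc i)) = 0\<^sub>m (r i) (r (Suc i))"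
  using assms resolution_carrier[of J r e A i]
  by (intro eq_matI) (auto simp: minimal_graded_free_resolution_def)

text \<open>Since \<open>r 0 = 1\<close>, the image of the first map depends on \<open>J\<close>
  alone, so two resolutions share it.\<close>

lemma resolution_image_1:
  assumes "graded_free_resolution J r e A"
  shows "mat_image (A (Suc 0)) = {v \<in> carrier_vec 1. v $ 0 \<in> J}"
proof -
  have J: "J = {v $ 0 | v. v \<in> mat_image (A (Suc 0))}"
    using assms by (simp add: graded_free_resolution_def)
  have "mat_image (A (Suc 0)) \<subseteq> carrier_vec 1"
    using resolution_carrier[OF assms, of 0] assms
    by (auto simp: mat_image_def graded_free_resolution_def)
  moreover have "v = w" if "v \<in> carrier_vec 1" "w \<in> carrier_vec 1" "v $ 0 = w $ 0" for v w :: "('a,'b) mpoly vec"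
    using that by (intro eq_vecI) auto
  ultimately show ?thesis unfolding J by blast
qed

text \<open>
  Only constant terms of the comparison maps \<open>U\<close> and \<open>V\<close> matter: \<open>V \<circ> U\<close> is homotopic to the identity,
  and by minimality the homotopy terms vanish modulo the variables. In the invariant of the
  induction, \<open>h\<close> is the homotopy, and the third equation says that \<open>V0 * U0 - 1 - A' (Suc i) * h\<close>
  vanishes on the image of \<open>A' (Suc i)\<close>.
\<close>

lemma minimal_rank_le:
  fixes J :: "('n::finite, 'k::field) mpoly set"
  assumes min: "minimal_graded_free_resolution J r e A" and min': "minimal_graded_free_resolution J r' e' A'"
  shows "r' i \<le> r i"
proof -
  let ?c = "map_mat (\<lambda>f :: ('n, 'k) mpoly. Poly_Mapping.lookup f 0)"
  have res: "graded_free_resolution J r e A" and res': "graded_free_resolution J r' e' A'"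
    using min min' by (simp_all add: minimal_graded_free_resolution_def)
  note AA = resolution_complex[OF res] and AA' = resolution_complex[OF res']
  have r0: "r 0 = 1" "r' 0 = 1" using res res' by (simp_all add: graded_free_resolution_def)
  have "\<exists>U0 U1 V0 V1 h. U0 \<in> carrier_mat (r i) (r' i) \<and> U1 \<in> carrier_mat (r (Suc i)) (r' (Suc i)) \<and>
      V0 \<in> carrier_mat (r' i) (r i) \<and> V1 \<in> carrier_mat (r' (Suc i)) (r (Suc i)) \<and>
      h \<in> carrier_mat (r' (Suc i)) (r' i) \<and>
      A (Suc i) * U1 = U0 * A' (Suc i) \<and> A' (Suc i) * V1 = V0 * A (Suc i) \<and>
      (V0 * U0) * A' (Suc i) = A' (Suc i) + A' (Suc i) * h * A' (Suc i) \<and>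
      ?c (V0 * U0) = 1\<^sub>m (r' i)"
  proof (induction i)
    case 0
    have im: "mat_image (A (Suc 0)) = mat_image (A' (Suc 0))"
      unfolding resolution_image_1[OF res] resolution_image_1[OF res'] ..
    have col_im: "col B j \<in> mat_image B" if "B \<in> carrier_mat a b" "j < b" for B :: "('n, 'k) mpoly mat" and a b j
    proof -
      have "col B j = B *\<^sub>v unit_vec b j" using that by (auto intro!: eq_vecI)
      then show ?thesis using that by (auto simp: mat_image_def)
    qed
    have "\<exists>X\<in>carrier_mat (r (Suc 0)) (r' (Suc 0)). A (Suc 0) * X = A' (Suc 0)"
      by (rule mat_factor_through[of _ 1]) (use im r0 col_im[of "A' (Suc 0)" 1 "r' (Suc 0)"]
          resolution_carrier[OF res, of 0] resolution_carrier[OF res', of 0] in auto)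
    moreover have "\<exists>X\<in>carrier_mat (r' (Suc 0)) (r (Suc 0)). A' (Suc 0) * X = A (Suc 0)"
      by (rule mat_factor_through[of _ 1]) (use im r0 col_im[of "A (Suc 0)" 1 "r (Suc 0)"]
          resolution_carrier[OF res, of 0] resolution_carrier[OF res', of 0] in auto)
    ultimately obtain U1 V1 where U1: "U1 \<in> carrier_mat (r (Suc 0)) (r' (Suc 0))" "A (Suc 0) * U1 = A' (Suc 0)"
      and V1: "V1 \<in> carrier_mat (r' (Suc 0)) (r (Suc 0))" "A' (Suc 0) * V1 = A (Suc 0)" by blast
    have c: "A (Suc 0) \<in> carrier_mat 1 (r (Suc 0))" "A' (Suc 0) \<in> carrier_mat 1 (r' (Suc 0))"
      using resolution_carrier[OF res, of 0] resolution_carrier[OF res', of 0] unfolding r0 by this+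
    \<comment> \<open>Both resolutions start with S, so the comparison begins with identities and
      the zero homotopy.\<close>
    show ?case
      by (rule exI[of _ "1\<^sub>m 1"], rule exI[of _ U1], rule exI[of _ "1\<^sub>m 1"], rule exI[of _ V1],
          rule exI[of _ "0\<^sub>m (r' (Suc 0)) 1"])
        (use U1 V1 c in \<open>simp add: r0 const_term.mat_hom_one\<close>)
  next
    case (Suc i)
    then obtain U0 U1 V0 V1 h where
      c: "U0 \<in> carrier_mat (r i) (r' i)" "U1 \<in> carrier_mat (r (Suc i)) (r' (Suc i))"
      "V0 \<in> carrier_mat (r' i) (r i)" "V1 \<in> carrier_mat (r' (Suc i)) (r (Suc i))"
      "h \<in> carrier_mat (r' (Suc i)) (r' i)"
      and U: "A (Suc i) * U1 = U0 * A' (Suc i)" and V: "A' (Suc i) * V1 = V0 * A (Suc i)"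
      and H: "(V0 * U0) * A' (Suc i) = A' (Suc i) + A' (Suc i) * h * A' (Suc i)" by blast
    let ?A1 = "A (Suc i)" and ?A2 = "A (Suc (Suc i))" and ?B1 = "A' (Suc i)" and ?B2 = "A' (Suc (Suc i))"
    have cA: "?A1 \<in> carrier_mat (r i) (r (Suc i))" "?A2 \<in> carrier_mat (r (Suc i)) (r (Suc (Suc i)))"
      "?B1 \<in> carrier_mat (r' i) (r' (Suc i))" "?B2 \<in> carrier_mat (r' (Suc i)) (r' (Suc (Suc i)))"
      by (rule resolution_carrier[OF res] resolution_carrier[OF res'])+
    have "?A1 * (U1 * ?B2) = 0\<^sub>m (r i) (r' (Suc (Suc i)))"
    proof -
      have "?A1 * (U1 * ?B2) = ?A1 * U1 * ?B2"
        by (rule assoc_mult_mat[OF cA(1) c(2) cA(4), symmetric])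
      also have "\<dots> = U0 * (?B1 * ?B2)" unfolding U by (rule assoc_mult_mat[OF c(1) cA(3,4)])
      also have "\<dots> = 0\<^sub>m (r i) (r' (Suc (Suc i)))" unfolding AA' using c(1) by simp
      finally show ?thesis .
    qed
    then obtain U2 where U2: "U2 \<in> carrier_mat (r (Suc (Suc i))) (r' (Suc (Suc i)))" "?A2 * U2 = U1 * ?B2"
      using resolution_lift[OF res mult_carrier_mat[OF c(2) cA(4)]] by blast
    have "?B1 * (V1 * ?A2) = 0\<^sub>m (r' i) (r (Suc (Suc i)))"
    proof -
      have "?B1 * (V1 * ?A2) = ?B1 * V1 * ?A2"
        by (rule assoc_mult_mat[OF cA(3) c(4) cA(2), symmetric])
      also have "\<dots> = V0 * (?A1 * ?A2)" unfolding V by (rule assoc_mult_mat[OF c(3) cA(1,2)])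
      also have "\<dots> = 0\<^sub>m (r' i) (r (Suc (Suc i)))" unfolding AA using c(3) by simp
      finally show ?thesis .
    qed
    then obtain V2 where V2: "V2 \<in> carrier_mat (r' (Suc (Suc i))) (r (Suc (Suc i)))" "?B2 * V2 = V1 * ?A2"
      using resolution_lift[OF res' mult_carrier_mat[OF c(4) cA(2)]] by blast
    let ?m = "r' (Suc i)"
    \<comment> \<open>By the invariant \<open>H\<close>, \<open>V1 * U1\<close> and
      \<open>?Y\<close> agree after applying \<open>?B1\<close>. Their difference lifts along
      \<open>?B2\<close> to \<open>k\<close>, the next piece of the homotopy.\<close>
    let ?Y = "1\<^sub>m ?m + h * ?B1"
    have cY: "?Y \<in> carrier_mat ?m ?m" "V1 * U1 \<in> carrier_mat ?m ?m" "h * ?B1 \<in> carrier_mat ?m ?m"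
      using mult_carrier_mat[OF c(4,2)] mult_carrier_mat[OF c(5) cA(3)] by simp_all
    have "?B1 * (V1 * U1 - ?Y) = 0\<^sub>m (r' i) ?m"
    proof -
      have "?B1 * (V1 * U1) = ?B1 * V1 * U1"
        by (rule assoc_mult_mat[OF cA(3) c(4,2), symmetric])
      also have "\<dots> = V0 * (?A1 * U1)" unfolding V by (rule assoc_mult_mat[OF c(3) cA(1) c(2)])
      also have "\<dots> = V0 * U0 * ?B1" unfolding U by (rule assoc_mult_mat[OF c(3,1) cA(3), symmetric])
      also have "\<dots> = ?B1 + ?B1 * h * ?B1" by (rule H)
      also have "?B1 * h * ?B1 = ?B1 * (h * ?B1)" by (rule assoc_mult_mat[OF cA(3) c(5) cA(3)])
      also have "?B1 + ?B1 * (h * ?B1) = ?B1 * ?Y"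
        using mult_add_distrib_mat[OF cA(3) one_carrier_mat cY(3)] cA(3) by simp
      finally have "?B1 * (V1 * U1) = ?B1 * ?Y" .
      then show ?thesis
        using mult_minus_distrib_mat[OF cA(3) cY(2,1)] minus_r_inv_mat[OF mult_carrier_mat[OF cA(3) cY(1)]]
        by simp
    qed
    then obtain k where k: "k \<in> carrier_mat (r' (Suc (Suc i))) ?m" "?B2 * k = V1 * U1 - ?Y"
      using resolution_lift[OF res' minus_carrier_mat[OF cY(1)]] by blast
    have VU: "V1 * U1 = ?Y + ?B2 * k"
      unfolding k(2) using cY(1,2) by (intro eq_matI) (auto simp del: index_mult_mat)
    have cBk: "?B2 * k \<in> carrier_mat ?m ?m" by (rule mult_carrier_mat[OF cA(4) k(1)])
    \<comment> \<open>Multiplication by \<open>?B2\<close> on the right kills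
      \<open>h * ?B1\<close>, so \<open>k\<close> takes the place of \<open>h\<close> in the
      invariant.\<close>
    have "(V1 * U1) * ?B2 = ?B2 + ?B2 * k * ?B2"
    proof -
      have "(V1 * U1) * ?B2 = ?Y * ?B2 + ?B2 * k * ?B2"
        unfolding VU by (rule add_mult_distrib_mat[OF cY(1) cBk cA(4)])
      also have "?Y * ?B2 = ?B2 + h * ?B1 * ?B2"
        using add_mult_distrib_mat[OF one_carrier_mat cY(3) cA(4)] cA(4) by simp
      also have "h * ?B1 * ?B2 = 0\<^sub>m ?m (r' (Suc (Suc i)))"
        unfolding assoc_mult_mat[OF c(5) cA(3,4)] AA' using c(5) by simp
      finally show ?thesis using cA(4) by simp
    qed
    moreover have "?c (V1 * U1) = 1\<^sub>m ?m"
    proof -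
      have "?c (?B2 * k) = 0\<^sub>m ?m ?m"
        unfolding const_term.mat_hom_mult[OF cA(4) k(1)] minimal_const_term[OF min'] using k(1) by simp
      moreover have "?c (h * ?B1) = 0\<^sub>m ?m ?m"
        unfolding const_term.mat_hom_mult[OF c(5) cA(3)] minimal_const_term[OF min'] using c(5) by simp
      moreover have "?c (V1 * U1) = ?c (1\<^sub>m ?m) + ?c (h * ?B1) + ?c (?B2 * k)"
        unfolding VU using cY(3) cBk
        by (intro eq_matI) (auto simp: const_term.hom_add simp del: index_mult_mat)
      ultimately show ?thesis by (simp add: const_term.mat_hom_one)
    qed
    ultimately show ?case
      using c U2 V2 k(1) by blast
  qed
  then obtain U0 V0 where "U0 \<in> carrier_mat (r i) (r' i)" "V0 \<in> carrier_mat (r' i) (r i)"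
    "?c (V0 * U0) = 1\<^sub>m (r' i)" by blast
  then show ?thesis
    using inverse_dim_le[of "?c V0" "r' i" "r i" "?c U0"] const_term.mat_hom_mult[of V0 "r' i" "r i" U0 "r' i"]
    by auto
qed

lemma betti_eq:
  assumes "minimal_graded_free_resolution J r e A"
  shows "betti i J = r i"
  unfolding betti_def
proof (rule the_equality)
  show "\<exists>r' e A. minimal_graded_free_resolution J r' e A \<and> r' i = r i" using assms by blast
  show "b = r i" if "\<exists>r e A. minimal_graded_free_resolution J r e A \<and> r i = b" for b
    using that minimal_rank_le[of J _ _ _ _ _ _ i] assms by (metis antisym)
qed

subsection \<open>Krull dimension and powers of ideals\<close>

text \<open>As \<open>P\<close> contains \<open>I\<close>, a coset belongs to the image exactly if
  its representative is in \<open>P\<close> (\<open>mem\<close>), and primality can be tested on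
  representatives.\<close>

lemma (in cring) quot_primeideal:
  assumes I: "ideal I R" and P: "primeideal P R" and IP: "I \<subseteq> P"
  shows "primeideal ((+>) I ` P) (R Quot I)"
proof (rule primeidealI)
  interpret P: primeideal P R by fact
  have idP: "ideal P R" using P primeideal.axioms(1) by blast
  show idQ: "ideal ((+>) I ` P) (R Quot I)" by (rule ring_ideal_imp_quot_ideal[OF I idP])
  have mem: "I +> a \<in> (+>) I ` P \<longleftrightarrow> a \<in> P" if "a \<in> carrier R" for a
  proof -
    have "(+>) I ` P \<subseteq> carrier (R Quot I)"
      using additive_subgroup.a_subset[OF ideal.axioms(1)[OF idQ]] .
    moreover have "\<Union> ((+>) I ` P) = P" using ideal_incl_iff[OF I idP] IP by simp
    ultimately show ?thesis using canonical_proj_vimage_mem_iff[OF I _ that] by metis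
  qed
  show "cring (R Quot I)" by (rule ideal.quotient_is_cring[OF I is_cring])
  have "\<one> \<notin> P" using P.one_imp_carrier P.I_notcarr by blast
  then have "I +> \<one> \<notin> (+>) I ` P" using mem by simp
  moreover have "I +> \<one> \<in> carrier (R Quot I)" by (auto simp: FactRing_def A_RCOSETS_def')
  ultimately show "carrier (R Quot I) \<noteq> (+>) I ` P" by blast
  fix a b assume a: "a \<in> carrier (R Quot I)" and b: "b \<in> carrier (R Quot I)"
    and ab: "a \<otimes>\<^bsub>R Quot I\<^esub> b \<in> (+>) I ` P"
  obtain x y where x: "x \<in> carrier R" "a = I +> x" and y: "y \<in> carrier R" "b = I +> y"
    using a b by (auto simp: FactRing_def A_RCOSETS_def')
  have "a \<otimes>\<^bsub>R Quot I\<^esub> b = I +> (x \<otimes> y)"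
    using ideal.rcoset_mult_add[OF I x(1) y(1)] x(2) y(2) by (simp add: FactRing_def)
  then have "x \<otimes> y \<in> P" using ab mem[of "x \<otimes> y"] x(1) y(1) by simp
  then have "x \<in> P \<or> y \<in> P" using P.I_prime[OF x(1) y(1)] by blast
  then show "a \<in> (+>) I ` P \<or> b \<in> (+>) I ` P" using mem x y by simp
qed

text \<open>A prime containing \<open>I\<close> is the union of its cosets, so strict inclusions
  survive in the quotient.\<close>

lemma (in cring) krull_dim_quot_ge:
  assumes I: "ideal I R" and P: "\<And>i. i \<le> l \<Longrightarrow> primeideal (P i) R \<and> I \<subseteq> P i"
    and strict: "\<And>i. i < l \<Longrightarrow> P i \<subset> P (Suc i)"
  shows "enat l \<le> krull_dim (R Quot I)"
  unfolding krull_dim_def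
proof (rule Sup_upper, intro CollectI exI[of _ l] exI[of _ "\<lambda>i. (+>) I ` P i"] conjI refl allI impI)
  show "primeideal ((+>) I ` P i) (R Quot I)" if "i \<le> l" for i
    using quot_primeideal[OF I] P[OF that] by blast
  have un: "\<Union> ((+>) I ` P i) = P i" if "i \<le> l" for i
  proof -
    have "ideal (P i) R" using P[OF that] primeideal.axioms(1) by blast
    then show ?thesis using ideal_incl_iff[OF I] P[OF that] by simp
  qed
  fix i assume i: "i < l"
  have "(+>) I ` P i \<noteq> (+>) I ` P (Suc i)"
  proof
    assume eq: "(+>) I ` P i = (+>) I ` P (Suc i)"
    have "P i = \<Union> ((+>) I ` P i)" by (rule un[symmetric]) (use i in simp)
    also have "\<dots> = P (Suc i)" unfolding eq by (rule un) (use i in simp)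
    finally have "P i = P (Suc i)" .
    then show False using strict[OF i] by blast
  qed
  then show "(+>) I ` P i \<subset> (+>) I ` P (Suc i)"
    using image_mono[OF psubset_imp_subset[OF strict[OF i]], of "(+>) I"] by (simp only: psubset_eq) simp
qed

section \<open>Powers of an ideal and the primes above them\<close>

lemma ideal_power_Suc:
  "ideal_power J (Suc k) = ideal_prod class_ring (ideal_power J k) J"
  by (simp add: ideals_set_def)

lemma ideal_power_0: "ideal_power J 0 = UNIV"
  by (simp add: ideals_set_def)

lemma ideal_ideal_power:
  assumes "ideal J class_ring"
  shows "ideal (ideal_power J k) class_ring"
proof (induction k)
  case 0
  show ?case unfolding ideal_power_0 by (rule class_ring_idealI) auto
next
  case (Suc k)
  show ?case unfolding ideal_power_Suc by (rule ring.ideal_prod_is_ideal[OF class_ring.ring_axioms Suc assms])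
qed

lemma ideal_power_1:
  fixes J :: "('n::finite, 'k::field) mpoly set"
  assumes "ideal J class_ring"
  shows "ideal_power J 1 = J"
proof -
  interpret M: comm_monoid "ideals_set (class_ring :: ('n, 'k) mpoly ring)"
    by (rule cring.ideals_set_is_comm_monoid[OF class_cring.cring_axioms])
  have "J \<in> carrier (ideals_set (class_ring :: ('n, 'k) mpoly ring))" using assms by (simp add: ideals_set_def)
  then show ?thesis using M.l_one by simp
qed

lemma ideal_prod_class_ring_mem:
  "a \<in> I \<Longrightarrow> b \<in> J \<Longrightarrow> a * b \<in> ideal_prod (class_ring :: 'a::comm_ring_1 ring) I J"
  using ideal_prod.prod[of a I b J "class_ring :: 'a ring"] by simp

lemma power_mem_ideal_power: "a \<in> J \<Longrightarrow> a ^ k \<in> ideal_power J k"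
proof (induction k)
  case (Suc k)
  then have "a ^ k * a \<in> ideal_power J (Suc k)"
    unfolding ideal_power_Suc by (intro ideal_prod_class_ring_mem)
  then show ?case by (simp only: power_Suc2)
qed (simp add: ideals_set_def)

lemma primeideal_power_mem:
  fixes P :: "'a::comm_ring_1 set"
  assumes "primeideal P class_ring" "a ^ k \<in> P"
  shows "a \<in> P"
  using assms(2)
proof (induction k)
  case 0
  interpret primeideal P class_ring by fact
  show ?case using one_imp_carrier 0 by simp
next
  case (Suc k)
  interpret primeideal P class_ring by fact
  show ?case using I_prime[of a "a ^ k"] Suc by auto
qed

text \<open>The chain is built above the power of \<open>I\<close>, but a prime containing
  \<open>a ^ k\<close> contains \<open>a\<close>, so it already lies above \<open>I\<close>.\<close>

lemma card_independent_le_ideal_dim: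
  fixes I :: "('n::finite, 'k::field) mpoly set"
  assumes inj: "inj \<iota>" and I: "ideal I class_ring"
    and ind: "\<And>f \<mu>. f \<in> ideal_power I k \<Longrightarrow> is_lead \<iota> f \<mu> \<Longrightarrow> \<not> Poly_Mapping.keys \<mu> \<subseteq> U"
  shows "enat (card U) \<le> ideal_dim I"
proof -
  have "\<exists>P. (\<forall>i\<le>card U. primeideal (P i) class_ring \<and> ideal_power I k \<subseteq> P i) \<and>
      (\<forall>i<card U. P i \<subset> P (Suc i))"
    by (rule prime_chain_of_independent[OF inj ideal_ideal_power[OF I]]) (rule ind)
  then obtain P where P: "\<forall>i\<le>card U. primeideal (P i) class_ring \<and> ideal_power I k \<subseteq> P i"
    "\<forall>i<card U. P i \<subset> P (Suc i)" by blast
  show ?thesis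
  proof (rule cring.krull_dim_quot_ge[OF class_cring.cring_axioms I])
    fix i assume i: "i \<le> card U"
    have "I \<subseteq> P i" using power_mem_ideal_power primeideal_power_mem P(1) i by blast
    then show "primeideal (P i) class_ring \<and> I \<subseteq> P i" using P(1) i by blast
  qed (use P(2) in blast)
qed

subsection \<open>Degrees of the generators of a linear resolution\<close>

lemma homogeneous_add:
  "homogeneous_of_degree d f \<Longrightarrow> homogeneous_of_degree d g \<Longrightarrow> homogeneous_of_degree d (f + g)"
  using keys_add[of f g] by (auto simp: homogeneous_of_degree_def)

lemma homogeneous_zero: "homogeneous_of_degree d 0"
  by (simp add: homogeneous_of_degree_def)

lemma homogeneous_sum:
  "(\<And>i. i \<in> X \<Longrightarrow> homogeneous_of_degree d (f i)) \<Longrightarrow> homogeneous_of_degree d (sum f X)"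
  by (induction X rule: infinite_finite_induct) (auto intro: homogeneous_add homogeneous_zero)

lemma monom_degree_add: "monom_degree (\<mu> + \<nu>) = monom_degree \<mu> + monom_degree \<nu>"
  by (simp add: monom_degree_def lookup_add sum.distrib)

lemma monom_degree_zero: "monom_degree 0 = 0"
  by (simp add: monom_degree_def)

lemma homogeneous_mult:
  "homogeneous_of_degree a f \<Longrightarrow> homogeneous_of_degree b g \<Longrightarrow> homogeneous_of_degree (a + b) (f * g)"
  using keys_mult[of f g] by (fastforce simp: homogeneous_of_degree_def monom_degree_add)

lemma homogeneous_degree_unique:
  "homogeneous_of_degree a f \<Longrightarrow> homogeneous_of_degree b f \<Longrightarrow> f \<noteq> 0 \<Longrightarrow> a = b"
  by (metis homogeneous_of_degree_def keys_eq_empty ex_in_conv)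

definition hom_part :: "int \<Rightarrow> ('n::finite, 'k::field) mpoly \<Rightarrow> ('n, 'k) mpoly" where
  "hom_part d f = Poly_Mapping.mapp (\<lambda>\<mu> c. if int (monom_degree \<mu>) = d then c else 0) f"

lemma lookup_hom_part:
  "Poly_Mapping.lookup (hom_part d f) \<mu> = (if int (monom_degree \<mu>) = d then Poly_Mapping.lookup f \<mu> else 0)"
  by (auto simp: hom_part_def lookup_mapp in_keys_iff when_def)

lemma homogeneous_hom_part: "homogeneous_of_degree d (hom_part d f)"
  by (auto simp: homogeneous_of_degree_def in_keys_iff lookup_hom_part split: if_splits)

lemma hom_part_add: "hom_part d (f + g) = hom_part d f + hom_part d g"
  by (intro poly_mapping_eqI) (simp add: lookup_hom_part lookup_add)

lemma hom_part_zero: "hom_part d 0 = 0"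
  by (intro poly_mapping_eqI) (simp add: lookup_hom_part)

lemma hom_part_sum: "hom_part d (sum f X) = (\<Sum>i\<in>X. hom_part d (f i))"
  by (induction X rule: infinite_finite_induct) (simp_all add: hom_part_add hom_part_zero)

lemma hom_part_homogeneous:
  "homogeneous_of_degree a f \<Longrightarrow> hom_part d f = (if a = d then f else 0)"
  by (intro poly_mapping_eqI) (auto simp: lookup_hom_part homogeneous_of_degree_def in_keys_iff)

text \<open>The components of \<open>f\<close> in degrees other than \<open>d - a\<close> contribute
  nothing to degree \<open>d\<close>.\<close>

lemma hom_part_mult:
  assumes "homogeneous_of_degree a g"
  shows "hom_part d (g * f) = g * hom_part (d - a) f"
proof -
  have 1: "homogeneous_of_degree d (g * hom_part (d - a) f)"
    using homogeneous_mult[OF assms homogeneous_hom_part, of "d - a" f] by simp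
  have "Poly_Mapping.lookup (g * (f - hom_part (d - a) f)) \<mu> = 0" if "int (monom_degree \<mu>) = d" for \<mu>
  proof (rule ccontr)
    assume "\<not> ?thesis"
    then have "\<mu> \<in> Poly_Mapping.keys (g * (f - hom_part (d - a) f))" by (simp add: in_keys_iff)
    then obtain \<alpha> \<beta> where "\<mu> = \<alpha> + \<beta>" "\<alpha> \<in> Poly_Mapping.keys g"
      "\<beta> \<in> Poly_Mapping.keys (f - hom_part (d - a) f)" using keys_mult by blast
    then show False using assms that
      by (auto simp: homogeneous_of_degree_def monom_degree_add in_keys_iff lookup_minus lookup_hom_part
          split: if_splits)
  qed
  then have 2: "hom_part d (g * (f - hom_part (d - a) f)) = 0"
    by (intro poly_mapping_eqI) (simp add: lookup_hom_part)
  have "hom_part d (g * f) = hom_part d (g * hom_part (d - a) f) + hom_part d (g * (f - hom_part (d - a) f))"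
    unfolding hom_part_add[symmetric] by (simp add: algebra_simps)
  then show ?thesis using 1 2 by (simp add: hom_part_homogeneous)
qed

lemma genideal_ideal_class_ring: "ideal (genideal class_ring G) (class_ring :: 'a::comm_ring_1 ring)"
  by (rule ring.genideal_ideal[OF class_ring.ring_axioms]) simp

lemma genideal_superset: "G \<subseteq> genideal (class_ring :: 'a::comm_ring_1 ring) G"
  by (rule ring.genideal_self[OF class_ring.ring_axioms]) simp

lemma genideal_least: "ideal K (class_ring :: 'a::comm_ring_1 ring) \<Longrightarrow> G \<subseteq> K \<Longrightarrow> genideal class_ring G \<subseteq> K"
  by (rule ring.genideal_minimal[OF class_ring.ring_axioms])

text \<open>Linear combinations built one term at a time; they yield an induction rule for
  \<open>genideal\<close>.\<close>

inductive_set lin_span :: "'a::comm_ring_1 set \<Rightarrow> 'a set" for G where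
  zero: "0 \<in> lin_span G"
| step: "f \<in> lin_span G \<Longrightarrow> g \<in> G \<Longrightarrow> f + s * g \<in> lin_span G"

lemma ideal_lin_span: "ideal (lin_span G) class_ring"
proof (rule class_ring_idealI)
  show "0 \<in> lin_span G" by (rule lin_span.zero)
  show "a + b \<in> lin_span G" if "a \<in> lin_span G" "b \<in> lin_span G" for a b
    using that(2,1)
  proof induction
    case (step f g s)
    then show ?case using lin_span.step[of "a + f" G g s] by (simp add: add.assoc)
  qed simp
  show "s * a \<in> lin_span G" if "a \<in> lin_span G" for a s
    using that
  proof induction
    case (step f g t)
    then show ?case using lin_span.step[of "s * f" G g "s * t"] by (simp add: algebra_simps)
  qed (simp add: lin_span.zero)
qed

lemma genideal_induct [consumes 1, case_names zero step]:
  fixes f :: "'a::comm_ring_1"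
  assumes f: "f \<in> genideal class_ring G" and zero: "P 0"
    and step: "\<And>f g s. P f \<Longrightarrow> g \<in> G \<Longrightarrow> P (f + s * g)"
  shows "P f"
proof -
  have "G \<subseteq> lin_span G" using lin_span.step[OF lin_span.zero, of _ G 1] by auto
  then have "f \<in> lin_span G" using f genideal_least[OF ideal_lin_span] by blast
  then show ?thesis by induction (auto intro: zero step)
qed

section \<open>Minimal resolutions in coordinates\<close>

locale minimal_resolution =
  fixes J :: "('n::finite, 'k::field) mpoly set" and r e A
  assumes minimal: "minimal_graded_free_resolution J r e A"
begin

lemma resolution: "graded_free_resolution J r e A"
  using minimal by (simp add: minimal_graded_free_resolution_def)

lemma carrier: "A (Suc i) \<in> carrier_mat (r i) (r (Suc i))"
  using resolution by (rule resolution_carrier)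

lemma entry_homogeneous:
  "p < r i \<Longrightarrow> q < r (Suc i) \<Longrightarrow> homogeneous_of_degree (e (Suc i) q - e i p) (A (Suc i) $$ (p, q))"
  using resolution by (simp add: graded_free_resolution_def)

lemma r0: "r 0 = 1" and e0: "e 0 0 = 0" and r_large: "CARD('n) < i \<Longrightarrow> r i = 0"
  using resolution by (simp_all add: graded_free_resolution_def)

lemma mult_mat_vec_index:
  assumes "p < r i"
  shows "(A (Suc i) *\<^sub>v vec (r (Suc i)) w) $ p = (\<Sum>q<r (Suc i). A (Suc i) $$ (p, q) * w q)"
  using carrier[of i] assms by (auto simp: scalar_prod_def atLeast0LessThan intro!: sum.cong)

lemma mem_J_iff: "f \<in> J \<longleftrightarrow> (\<exists>w. f = (\<Sum>q<r 1. A 1 $$ (0, q) * w q))"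
proof
  assume "f \<in> J"
  then obtain v where "v \<in> mat_image (A 1)" "f = v $ 0"
    using resolution by (auto simp: graded_free_resolution_def)
  then obtain u where u: "u \<in> carrier_vec (r 1)" "f = (A 1 *\<^sub>v u) $ 0"
    using carrier[of 0] by (auto simp: mat_image_def)
  have "u = vec (r 1) (vec_index u)" using u(1) by (intro eq_vecI) auto
  then show "\<exists>w. f = (\<Sum>q<r 1. A 1 $$ (0, q) * w q)"
    using mult_mat_vec_index[of 0 0 "vec_index u"] r0 u by auto
next
  assume "\<exists>w. f = (\<Sum>q<r 1. A 1 $$ (0, q) * w q)"
  then obtain w where "f = (A 1 *\<^sub>v vec (r 1) w) $ 0"
    using mult_mat_vec_index[of 0 0] r0 by auto
  moreover have "A 1 *\<^sub>v vec (r 1) w \<in> mat_image (A 1)"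
    using carrier[of 0] by (auto simp: mat_image_def)
  ultimately show "f \<in> J" using resolution by (auto simp: graded_free_resolution_def)
qed

lemma exact:
  "(\<forall>p<r i. (\<Sum>q<r (Suc i). A (Suc i) $$ (p, q) * w q) = 0) \<longleftrightarrow>
     (\<exists>u. \<forall>q<r (Suc i). w q = (\<Sum>l<r (Suc (Suc i)). A (Suc (Suc i)) $$ (q, l) * u l))"
proof -
  let ?w = "vec (r (Suc i)) w"
  have "(\<forall>p<r i. (\<Sum>q<r (Suc i). A (Suc i) $$ (p, q) * w q) = 0) \<longleftrightarrow> A (Suc i) *\<^sub>v ?w = 0\<^sub>v (r i)"
    using carrier[of i] mult_mat_vec_index[of _ i w] by (auto simp: vec_eq_iff simp del: index_mult_mat_vec)
  also have "\<dots> \<longleftrightarrow> ?w \<in> mat_kernel (A (Suc i))"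
    using carrier[of i] by (auto simp: mat_kernel_def)
  also have "\<dots> \<longleftrightarrow> ?w \<in> mat_image (A (Suc (Suc i)))"
    using resolution by (simp add: graded_free_resolution_def)
  also have "\<dots> \<longleftrightarrow> (\<exists>u. \<forall>q<r (Suc i). w q = (\<Sum>l<r (Suc (Suc i)). A (Suc (Suc i)) $$ (q, l) * u l))"
  proof
    assume "?w \<in> mat_image (A (Suc (Suc i)))"
    then obtain u where u: "u \<in> carrier_vec (r (Suc (Suc i)))" "?w = A (Suc (Suc i)) *\<^sub>v u"
      using carrier[of "Suc i"] by (auto simp: mat_image_def)
    have uu: "vec (r (Suc (Suc i))) (vec_index u) = u" using u(1) by (intro eq_vecI) auto
    have eq: "?w = A (Suc (Suc i)) *\<^sub>v vec (r (Suc (Suc i))) (vec_index u)" unfolding uu by (rule u(2))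
    have "w q = (\<Sum>l<r (Suc (Suc i)). A (Suc (Suc i)) $$ (q, l) * u $ l)" if q: "q < r (Suc i)" for q
    proof -
      have "w q = ?w $ q" using q by simp
      then show ?thesis unfolding eq mult_mat_vec_index[OF q] .
    qed
    then show "\<exists>u. \<forall>q<r (Suc i). w q = (\<Sum>l<r (Suc (Suc i)). A (Suc (Suc i)) $$ (q, l) * u l)" by blast
  next
    assume "\<exists>u. \<forall>q<r (Suc i). w q = (\<Sum>l<r (Suc (Suc i)). A (Suc (Suc i)) $$ (q, l) * u l)"
    then obtain u where u: "\<And>q. q < r (Suc i) \<Longrightarrow> w q = (\<Sum>l<r (Suc (Suc i)). A (Suc (Suc i)) $$ (q, l) * u l)"
      by blast
    have "?w = A (Suc (Suc i)) *\<^sub>v vec (r (Suc (Suc i))) u"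
      using carrier[of "Suc i"] mult_mat_vec_index[of _ "Suc i" u] u
      by (intro eq_vecI) (auto simp del: index_mult_mat_vec)
    then show "?w \<in> mat_image (A (Suc (Suc i)))"
      using carrier[of "Suc i"] by (auto simp: mat_image_def)
  qed
  finally show ?thesis .
qed

text \<open>By exactness a syzygy is in the image of the next matrix, whose entries have no constant
  term.\<close>

lemma syzygy_const_term:
  assumes "\<And>p. p < r i \<Longrightarrow> (\<Sum>q<r (Suc i). A (Suc i) $$ (p, q) * w q) = 0" and q: "q < r (Suc i)"
  shows "Poly_Mapping.lookup (w q) 0 = 0"
proof -
  obtain u where "w q = (\<Sum>l<r (Suc (Suc i)). A (Suc (Suc i)) $$ (q, l) * u l)"
    using exact[of i w] assms by blast
  moreover have "Poly_Mapping.lookup (A (Suc (Suc i)) $$ (q, l)) 0 = 0" if "l < r (Suc (Suc i))" for l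
    using minimal that q by (simp add: minimal_graded_free_resolution_def)
  ultimately show ?thesis by (simp add: lookup_sum lookup_mult_zero)
qed

text \<open>A zero column would make a unit vector a syzygy, with constant entry 1.\<close>

lemma column_nonzero:
  assumes q: "q < r (Suc i)"
  shows "\<exists>p<r i. A (Suc i) $$ (p, q) \<noteq> 0"
proof (rule ccontr)
  assume neg: "\<not> ?thesis"
  have "Poly_Mapping.lookup ((\<lambda>l. if l = q then 1 else 0 :: ('n, 'k) mpoly) q) 0 = 0"
  proof (rule syzygy_const_term[where w = "\<lambda>l. if l = q then 1 else 0", OF _ q])
    fix p assume "p < r i"
    then have "A (Suc i) $$ (p, q) = 0" using neg by blast
    then show "(\<Sum>l<r (Suc i). A (Suc i) $$ (p, l) * (if l = q then 1 else 0)) = 0"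
      by (intro sum.neutral) auto
  qed
  then show False by simp
qed

text \<open>Otherwise the difference of the two sides would be a syzygy with a nonzero constant entry.\<close>

lemma generator_not_combination:
  assumes q: "q < r 1" and eq: "A 1 $$ (0, q) = (\<Sum>p<r 1. A 1 $$ (0, p) * w p)"
  shows "Poly_Mapping.lookup (w q) 0 = 1"
proof -
  let ?u = "\<lambda>p. (if p = q then 1 else 0) - w p"
  have "Poly_Mapping.lookup (?u q) 0 = 0"
  proof (rule syzygy_const_term[where i = 0 and w = ?u])
    fix p assume "p < r 0"
    then have p: "p = 0" using r0 by simp
    have "(\<Sum>l<r 1. A 1 $$ (0, l) * ?u l)
        = (\<Sum>l<r 1. if l = q then A 1 $$ (0, l) else 0) - (\<Sum>l<r 1. A 1 $$ (0, l) * w l)"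
      unfolding sum_subtractf[symmetric] by (intro sum.cong) (auto simp: algebra_simps)
    also have "\<dots> = 0" using q eq by simp
    finally show "(\<Sum>l<r (Suc 0). A (Suc 0) $$ (p, l) * ?u l) = 0" using p by simp
  qed (use q in simp)
  then show ?thesis by (simp add: lookup_minus)
qed

lemma generator_mem_J: "q < r 1 \<Longrightarrow> A 1 $$ (0, q) \<in> J"
  unfolding mem_J_iff by (intro exI[of _ "\<lambda>l. if l = q then 1 else 0"]) (simp add: if_distrib cong: if_cong)

lemma generator_homogeneous: "q < r 1 \<Longrightarrow> homogeneous_of_degree (e 1 q) (A 1 $$ (0, q))"
  using entry_homogeneous[of 0 0 q] r0 e0 by simp

lemma hom_part_mem_J:
  assumes "f \<in> J"
  shows "hom_part a f \<in> J"
proof -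
  obtain w where "f = (\<Sum>q<r 1. A 1 $$ (0, q) * w q)" using assms mem_J_iff by blast
  then have "hom_part a f = (\<Sum>q<r 1. A 1 $$ (0, q) * hom_part (a - e 1 q) (w q))"
    using hom_part_mult[OF generator_homogeneous] by (simp add: hom_part_sum)
  then show ?thesis unfolding mem_J_iff by (rule exI[of _ "\<lambda>q. hom_part (a - e 1 q) (w q)"])
qed

lemma ideal_J: "ideal J class_ring"
proof (rule class_ring_idealI)
  show "0 \<in> J" unfolding mem_J_iff by (intro exI[of _ "\<lambda>_. 0"]) simp
  show "f + g \<in> J" if fg: "f \<in> J" "g \<in> J" for f g
  proof -
    obtain v w where "f = (\<Sum>q<r 1. A 1 $$ (0, q) * v q)" "g = (\<Sum>q<r 1. A 1 $$ (0, q) * w q)"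
      using fg mem_J_iff by blast
    then have "f + g = (\<Sum>q<r 1. A 1 $$ (0, q) * (v q + w q))" by (simp add: distrib_left sum.distrib)
    then show ?thesis unfolding mem_J_iff by (rule exI[of _ "\<lambda>q. v q + w q"])
  qed
  show "s * f \<in> J" if f: "f \<in> J" for f s
  proof -
    obtain v where "f = (\<Sum>q<r 1. A 1 $$ (0, q) * v q)" using f mem_J_iff by blast
    then have "s * f = (\<Sum>q<r 1. A 1 $$ (0, q) * (s * v q))" by (simp add: sum_distrib_left ac_simps)
    then show ?thesis unfolding mem_J_iff by (rule exI[of _ "\<lambda>q. s * v q"])
  qed
qed

text \<open>An omitted generator would be a combination of the others, against
  \<open>generator_not_combination\<close>. The result is what \<open>generated_in_degree\<close>
  can be applied to.\<close>

lemma minimal_generators: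
  "minimal_homogeneous_generating_set J {A 1 $$ (0, q) | q. q < r 1}"
proof -
  let ?G = "{A 1 $$ (0, q) | q. q < r 1}"
  have "J \<subseteq> genideal class_ring ?G"
  proof
    fix f assume "f \<in> J"
    then obtain w where f: "f = (\<Sum>q<r 1. A 1 $$ (0, q) * w q)" using mem_J_iff by blast
    have "(\<Sum>q<m. A 1 $$ (0, q) * w q) \<in> genideal class_ring ?G" if "m \<le> r 1" for m
      using that
    proof (induction m)
      case 0
      show ?case using class_ring_idealD(1)[OF genideal_ideal_class_ring, of ?G] by simp
    next
      case (Suc m)
      then have "A 1 $$ (0, m) \<in> ?G" by auto
      then have "A 1 $$ (0, m) \<in> genideal class_ring ?G" by (rule subsetD[OF genideal_superset])
      then have "w m * A 1 $$ (0, m) \<in> genideal class_ring ?G"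
        by (rule class_ring_idealD(3)[OF genideal_ideal_class_ring])
      then have "(\<Sum>q<m. A 1 $$ (0, q) * w q) + w m * A 1 $$ (0, m) \<in> genideal class_ring ?G"
        using Suc by (intro class_ring_idealD(2)[OF genideal_ideal_class_ring]) auto
      then show ?case by (simp add: mult.commute)
    qed
    then show "f \<in> genideal class_ring ?G" using f by blast
  qed
  moreover have "genideal class_ring ?G \<subseteq> J"
    by (rule genideal_least[OF ideal_J]) (use generator_mem_J in auto)
  ultimately have gen: "homogeneous_generating_set J ?G"
    unfolding homogeneous_generating_set_def using generator_homogeneous by blast
  have "\<not> homogeneous_generating_set J H" if H: "H \<subset> ?G" for H
  proof
    assume "homogeneous_generating_set J H"
    then have gH: "genideal class_ring H = J" by (simp add: homogeneous_generating_set_def)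
    obtain q where q: "q < r 1" "A 1 $$ (0, q) \<notin> H" using H by blast
    have "f \<in> genideal class_ring H \<Longrightarrow> \<exists>w. w q = 0 \<and> f = (\<Sum>p<r 1. A 1 $$ (0, p) * w p)" for f
    proof (induction rule: genideal_induct)
      case zero
      show ?case by (intro exI[of _ "\<lambda>_. 0"]) simp
    next
      case (step f g s)
      then obtain w where w: "w q = 0" "f = (\<Sum>p<r 1. A 1 $$ (0, p) * w p)" by blast
      \<comment> \<open>Generator \<open>q\<close> is not in \<open>H\<close>, so \<open>g\<close>
        has another index and the coefficient at \<open>q\<close> stays 0.\<close>
      obtain p where p: "p < r 1" "g = A 1 $$ (0, p)" "p \<noteq> q" using step(2) H q by blast
      have "f + s * g = (\<Sum>l<r 1. A 1 $$ (0, l) * w l) + (\<Sum>l<r 1. if l = p then A 1 $$ (0, l) * s else 0)"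
        using w(2) p(1,2) by (simp add: mult.commute)
      also have "\<dots> = (\<Sum>l<r 1. A 1 $$ (0, l) * (w l + (if l = p then s else 0)))"
        unfolding sum.distrib[symmetric] by (intro sum.cong) (auto simp: distrib_left)
      finally show ?case using w(1) p(3)
        by (intro exI[of _ "\<lambda>l. w l + (if l = p then s else 0)"]) simp
    qed
    moreover have "A 1 $$ (0, q) \<in> genideal class_ring H" unfolding gH by (rule generator_mem_J[OF q(1)])
    ultimately obtain w where "w q = 0" "A 1 $$ (0, q) = (\<Sum>p<r 1. A 1 $$ (0, p) * w p)" by blast
    then show False using generator_not_combination[OF q(1), of w] by simp
  qed
  then show ?thesis using gen by (simp add: minimal_homogeneous_generating_set_def)
qed

text \<open>
  A generator of degree \<open>a \<noteq> N\<close> is an \<open>S\<close>-combination of elements of degree \<open>N\<close>; in degree \<open>a\<close> the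
  coefficients have no constant term.
\<close>

lemma generator_degree:
  assumes gen: "J \<subseteq> genideal class_ring {g \<in> J. homogeneous_of_degree N g}" and q: "q < r 1"
  shows "e 1 q = N"
proof (rule ccontr)
  assume neq: "e 1 q \<noteq> N"
  let ?a = "e 1 q"
  have "f \<in> genideal class_ring {g \<in> J. homogeneous_of_degree N g} \<Longrightarrow>
      \<exists>w. Poly_Mapping.lookup (w q) 0 = 0 \<and> hom_part ?a f = (\<Sum>p<r 1. A 1 $$ (0, p) * w p)" for f
  proof (induction rule: genideal_induct)
    case zero
    show ?case by (intro exI[of _ "\<lambda>_. 0"]) (simp add: hom_part_zero)
  next
    case (step f g s)
    then obtain w where w: "Poly_Mapping.lookup (w q) 0 = 0" "hom_part ?a f = (\<Sum>p<r 1. A 1 $$ (0, p) * w p)"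
      by blast
    obtain v where v: "g = (\<Sum>p<r 1. A 1 $$ (0, p) * v p)" using step(2) mem_J_iff by blast
    let ?t = "hom_part (?a - N) s"
    have t: "Poly_Mapping.lookup ?t 0 = 0" using neq by (simp add: lookup_hom_part monom_degree_zero)
    have "hom_part ?a (f + s * g) = hom_part ?a f + g * ?t"
      using hom_part_mult[of N g ?a s] step(2) by (simp add: hom_part_add mult.commute)
    also have "\<dots> = (\<Sum>p<r 1. A 1 $$ (0, p) * (w p + v p * ?t))"
    proof -
      have "g * ?t = (\<Sum>p<r 1. A 1 $$ (0, p) * (v p * ?t))"
        unfolding sum_distrib_right[symmetric] mult.assoc[symmetric] using v by simp
      then show ?thesis unfolding w(2) by (simp add: distrib_left sum.distrib)
    qed
    finally show ?case using w(1) t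
      by (intro exI[of _ "\<lambda>p. w p + v p * ?t"]) (simp add: lookup_add lookup_mult_zero)
  qed
  then obtain w where "Poly_Mapping.lookup (w q) 0 = 0"
    "hom_part ?a (A 1 $$ (0, q)) = (\<Sum>p<r 1. A 1 $$ (0, p) * w p)"
    using gen generator_mem_J[OF q] by blast
  then show False
    using generator_not_combination[OF q, of w] hom_part_homogeneous[OF generator_homogeneous[OF q]] by simp
qed

text \<open>Each column has a nonzero entry; its degree is the difference of two generator degrees
  by the grading and 1 by linearity.\<close>

lemma linear_degrees:
  assumes lin: "\<And>i p q. i > 1 \<Longrightarrow> p < r (i - 1) \<Longrightarrow> q < r i \<Longrightarrow> A i $$ (p, q) \<noteq> 0 \<Longrightarrow>
      homogeneous_of_degree 1 (A i $$ (p, q))"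
    and gen: "J \<subseteq> genideal class_ring {g \<in> J. homogeneous_of_degree N g}"
  shows "q < r (Suc i) \<Longrightarrow> e (Suc i) q = N + int i"
proof (induction i arbitrary: q)
  case 0
  then show ?case using generator_degree[OF gen] by simp
next
  case (Suc i)
  obtain p where p: "p < r (Suc i)" "A (Suc (Suc i)) $$ (p, q) \<noteq> 0"
    using column_nonzero[OF Suc.prems] by blast
  have "homogeneous_of_degree 1 (A (Suc (Suc i)) $$ (p, q))"
    using lin[of "Suc (Suc i)" p q] p Suc.prems by simp
  then have "e (Suc (Suc i)) q - e (Suc i) p = 1"
    using homogeneous_degree_unique[OF entry_homogeneous[OF p(1) Suc.prems] _ p(2)] by simp
  then show ?case using Suc.IH[OF p(1)] by simp
qed

end

text \<open>Linearity constrains only the maps after the first, so the degree of the generators of a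
  power has to come from products of generators. One factor is reduced at a time: in
  \<open>gj\<close> the one in \<open>I\<close>, in \<open>ij\<close> the one in the lower
  power.\<close>

lemma ideal_power_generated:
  fixes I :: "('n::finite, 'k::field) mpoly set"
  assumes I: "ideal I class_ring"
    and gen: "I \<subseteq> genideal class_ring {g \<in> I. homogeneous_of_degree d g}"
  shows "ideal_power I k \<subseteq>
    genideal class_ring {g \<in> ideal_power I k. homogeneous_of_degree (d * int k) g}"
proof (induction k)
  case 0
  have "1 \<in> {g \<in> ideal_power I 0. homogeneous_of_degree (d * int 0) g}"
    unfolding ideal_power_0 by (auto simp: homogeneous_of_degree_def monom_degree_zero)
  then have "1 \<in> genideal class_ring {g \<in> ideal_power I 0. homogeneous_of_degree (d * int 0) g}"
    by (rule subsetD[OF genideal_superset])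
  then have "s * 1 \<in> genideal class_ring {g \<in> ideal_power I 0. homogeneous_of_degree (d * int 0) g}" for s
    by (rule class_ring_idealD(3)[OF genideal_ideal_class_ring])
  then show ?case by auto
next
  case (Suc k)
  let ?H = "{g \<in> ideal_power I (Suc k). homogeneous_of_degree (d * int (Suc k)) g}"
  let ?K = "genideal class_ring ?H"
  note K = class_ring_idealD[OF genideal_ideal_class_ring[of ?H]]
  have gj: "j \<in> genideal class_ring {g \<in> I. homogeneous_of_degree d g} \<Longrightarrow> g * j \<in> ?K"
    if g: "g \<in> ideal_power I k" "homogeneous_of_degree (d * int k) g" for g j
  proof (induction rule: genideal_induct)
    case zero
    show ?case using K(1) by simp
  next
    case (step f h s)
    have "g * h \<in> ideal_power I (Suc k)"
      unfolding ideal_power_Suc using g(1) step(2) by (intro ideal_prod_class_ring_mem) auto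
    moreover have "homogeneous_of_degree (d * int (Suc k)) (g * h)"
      using homogeneous_mult[OF g(2), of d h] step(2) by (simp add: algebra_simps)
    ultimately have "g * h \<in> ?K" by (intro subsetD[OF genideal_superset]) simp
    then have "g * f + s * (g * h) \<in> ?K" using step(1) by (intro K(2)[OF _ K(3)])
    then show ?case by (simp add: algebra_simps)
  qed
  have ij: "i \<in> genideal class_ring {g \<in> ideal_power I k. homogeneous_of_degree (d * int k) g} \<Longrightarrow>
      j \<in> I \<Longrightarrow> i * j \<in> ?K" for i j
  proof (induction rule: genideal_induct)
    case zero
    show ?case using K(1) by simp
  next
    case (step f g s)
    have "g * j \<in> ?K" using gj[of g j] step(2,3) gen by auto
    then have "f * j + s * (g * j) \<in> ?K" using step(1,3) by (intro K(2)[OF _ K(3)])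
    then show ?case by (simp add: algebra_simps)
  qed
  show ?case
  proof
    fix x assume "x \<in> ideal_power I (Suc k)"
    then have "x \<in> ideal_prod class_ring (ideal_power I k) I" by (simp only: ideal_power_Suc)
    then show "x \<in> ?K"
    proof induction
      case (prod i j)
      then show ?case using ij[of i j] Suc.IH by auto
    next
      case (sum s t)
      then show ?case using K(2) by simp
    qed
  qed
qed

subsection \<open>The Hilbert function\<close>

text \<open>Rank-nullity on a subspace: a basis of the kernel is extended to one of
  \<open>V\<close>, and the added vectors map to a basis of the image.\<close>

lemma (in Vector_Spaces.linear) dim_kernel_plus_image:
  assumes V: "vs1.subspace V" and W: "finite W" "V \<subseteq> vs1.span W"
  shows "vs1.dim V = vs1.dim {v \<in> V. f v = 0} + vs2.dim (f ` V)"
proof -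
  let ?K = "{v \<in> V. f v = 0}"
  obtain B where B: "B \<subseteq> ?K" "vs1.independent B" "?K \<subseteq> vs1.span B" "card B = vs1.dim ?K"
    by (rule vs1.basis_exists)
  obtain B' where B': "B \<subseteq> B'" "B' \<subseteq> V" "vs1.independent B'" "V \<subseteq> vs1.span B'"
    using vs1.maximal_independent_subset_extend[of B V] B(1,2) by blast
  have fin: "finite B'"
    using vs1.independent_span_bound[OF W(1) B'(3)] B'(2) W(2) by blast
  let ?C = "B' - B"
  have indC: "vs1.independent ?C" using B'(3) vs1.independent_mono by blast
  have CV: "vs1.span ?C \<subseteq> V" by (rule vs1.span_minimal[OF _ V]) (use B'(2) in blast)
  have inj: "inj_on f (vs1.span ?C)"
    unfolding inj_on_iff_eq_0[OF vs1.subspace_span]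
  proof (intro ballI impI)
    fix x assume x: "x \<in> vs1.span ?C" "f x = 0"
    then have xB: "x \<in> vs1.span B" using CV B(3) by blast
    have xB': "x \<in> vs1.span B'" using xB vs1.span_mono[OF B'(1)] by blast
    \<comment> \<open>\<open>x\<close> lies in the spans of the disjoint sets \<open>B\<close> and
      \<open>?C\<close>; its coordinates over \<open>B'\<close> agree with both representations and
      hence vanish.\<close>
    have "vs1.representation B' x = vs1.representation B x"
      by (rule vs1.representation_extend[OF B'(3) xB B'(1)])
    moreover have "vs1.representation B' x = vs1.representation ?C x"
      by (rule vs1.representation_extend[OF B'(3) x(1)]) blast
    ultimately have "vs1.representation B' x b = 0" for b
      using vs1.representation_ne_zero[of B x b] vs1.representation_ne_zero[of ?C x b] by (metis DiffD2)
    then show "x = 0"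
      using vs1.sum_representation_eq[OF B'(3) xB' fin subset_refl] by simp
  qed
  have indfC: "vs2.independent (f ` ?C)" by (rule independent_injective_image[OF indC inj])
  have "f ` V \<subseteq> vs2.span (f ` ?C)"
  proof -
    have "f ` V \<subseteq> vs2.span (f ` B')" unfolding span_image using B'(4) by blast
    also have "\<dots> \<subseteq> vs2.span (f ` ?C)"
    proof (rule vs2.span_minimal[OF _ vs2.subspace_span])
      show "f ` B' \<subseteq> vs2.span (f ` ?C)"
      proof
        fix y assume "y \<in> f ` B'"
        then obtain b where b: "b \<in> B'" "y = f b" by blast
        show "y \<in> vs2.span (f ` ?C)"
        proof (cases "b \<in> B")
          case True
          then show ?thesis using B(1) b(2) vs2.span_zero by auto
        next
          case False
          then show ?thesis using b vs2.span_base[of y "f ` ?C"] by blast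
        qed
      qed
    qed
    finally show ?thesis .
  qed
  then have "vs2.dim (f ` V) = card (f ` ?C)"
    by (intro vs2.basis_card_eq_dim[symmetric] image_mono indfC) (use B'(2) in blast)
  also have "\<dots> = card ?C" by (rule card_image) (use inj vs1.span_superset inj_on_subset in blast)
  also have "\<dots> = card B' - card B" using card_Diff_subset[OF finite_subset[OF B'(1) fin] B'(1)] .
  finally have "vs2.dim (f ` V) = vs1.dim V - vs1.dim ?K"
    using B(4) vs1.basis_card_eq_dim[OF B'(2,4,3)] by simp
  moreover have "card B \<le> card B'" by (rule card_mono[OF fin B'(1)])
  ultimately show ?thesis using B(4) vs1.basis_card_eq_dim[OF B'(2,4,3)] by simp
qed

section \<open>Graded pieces of free modules as vector spaces\<close>

definition vscale :: "'k::field \<Rightarrow> (nat \<Rightarrow> ('n::finite, 'k) mpoly) \<Rightarrow> nat \<Rightarrow> ('n, 'k) mpoly" where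
  "vscale c v = (\<lambda>p. Poly_Mapping.single 0 c * v p)"

lemma lookup_const_mult:
  fixes f :: "('n::finite, 'k::field) mpoly"
  shows "Poly_Mapping.lookup (Poly_Mapping.single 0 c * f) \<mu> = c * Poly_Mapping.lookup f \<mu>"
  unfolding mult_map_scale_conv_mult[symmetric] by (simp add: Poly_Mapping.map.rep_eq when_def)

interpretation VS: vector_space "vscale :: 'k::field \<Rightarrow> (nat \<Rightarrow> ('n::finite, 'k) mpoly) \<Rightarrow> _"
proof
  fix a b :: 'k and x y :: "nat \<Rightarrow> ('n, 'k) mpoly"
  show "vscale a (x + y) = vscale a x + vscale a y"
    by (simp add: vscale_def fun_eq_iff distrib_left)
  show "vscale (a + b) x = vscale a x + vscale b x"
    by (simp add: vscale_def fun_eq_iff distrib_right single_add)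
  show "vscale a (vscale b x) = vscale (a * b) x"
    by (simp add: vscale_def fun_eq_iff mult.assoc[symmetric] mult_single)
  show "vscale 1 x = x"
    by (simp add: vscale_def)
qed

lemma homogeneous_const_mult:
  "homogeneous_of_degree d f \<Longrightarrow> homogeneous_of_degree d (Poly_Mapping.single 0 c * f)"
  by (auto simp: homogeneous_of_degree_def in_keys_iff lookup_const_mult)

lemma sum_fun_apply: "(\<Sum>i\<in>X. v i) p = (\<Sum>i\<in>X. v i p)" for v :: "'i \<Rightarrow> 'a \<Rightarrow> 'b::comm_monoid_add"
  by (induction X rule: infinite_finite_induct) simp_all

text \<open>A triangularity criterion: among the vectors with nonzero coefficient in a vanishing
  combination, one has a coordinate where all the others are 0. It covers monomial bases as well as
  distinct leading monomials.\<close>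

lemma independent_by_coordinates:
  fixes v :: "'i \<Rightarrow> nat \<Rightarrow> ('n::finite, 'k::field) mpoly"
  assumes fin: "finite X"
    and coord: "\<And>Y. Y \<subseteq> X \<Longrightarrow> Y \<noteq> {} \<Longrightarrow> \<exists>i\<in>Y. Poly_Mapping.lookup (v i (pos i)) (ex i) \<noteq> 0 \<and>
        (\<forall>j\<in>Y. j \<noteq> i \<longrightarrow> Poly_Mapping.lookup (v j (pos i)) (ex i) = 0)"
  shows "inj_on v X" and "VS.independent (v ` X)"
proof -
  show inj: "inj_on v X"
  proof (rule inj_onI, rule ccontr)
    fix i j assume ij: "i \<in> X" "j \<in> X" "v i = v j" "i \<noteq> j"
    then obtain l where "l \<in> {i, j}" "Poly_Mapping.lookup (v l (pos l)) (ex l) \<noteq> 0"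
      "\<forall>m\<in>{i, j}. m \<noteq> l \<longrightarrow> Poly_Mapping.lookup (v m (pos l)) (ex l) = 0"
      using coord[of "{i, j}"] by blast
    then show False using ij by force
  qed
  show "VS.independent (v ` X)"
  proof (rule VS.independent_if_scalars_zero)
    show "finite (v ` X)" using fin by simp
    fix c x assume zero: "(\<Sum>x\<in>v ` X. vscale (c x) x) = 0" and x: "x \<in> v ` X"
    define Y where "Y = {i \<in> X. c (v i) \<noteq> 0}"
    have "Y = {}"
    proof (rule ccontr)
      assume "Y \<noteq> {}"
      then obtain i where i: "i \<in> Y" "Poly_Mapping.lookup (v i (pos i)) (ex i) \<noteq> 0"
        "\<And>j. j \<in> Y \<Longrightarrow> j \<noteq> i \<Longrightarrow> Poly_Mapping.lookup (v j (pos i)) (ex i) = 0"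
        using coord[of Y] by (auto simp: Y_def)
      have "0 = (\<Sum>j\<in>X. vscale (c (v j)) (v j))" using zero by (simp add: sum.reindex[OF inj])
      then have "0 = (\<Sum>j\<in>X. vscale (c (v j)) (v j)) (pos i)" by (simp add: fun_eq_iff)
      then have "0 = Poly_Mapping.lookup ((\<Sum>j\<in>X. vscale (c (v j)) (v j)) (pos i)) (ex i)"
        by (metis lookup_zero)
      then have "0 = (\<Sum>j\<in>X. c (v j) * Poly_Mapping.lookup (v j (pos i)) (ex i))"
        unfolding sum_fun_apply lookup_sum vscale_def lookup_const_mult .
      also have "\<dots> = (\<Sum>j\<in>X. if j = i then c (v i) * Poly_Mapping.lookup (v i (pos i)) (ex i) else 0)"
        by (rule sum.cong) (use i(3) in \<open>auto simp: Y_def\<close>)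
      also have "\<dots> = c (v i) * Poly_Mapping.lookup (v i (pos i)) (ex i)"
        using i(1) fin by (simp add: Y_def)
      finally show False using i by (simp add: Y_def)
    qed
    then show "c x = 0" using x by (auto simp: Y_def)
  qed
qed

text \<open>Degrees are integers because shifts by generator degrees may be negative; then there are
  no monomials.\<close>

definition monoms_of_int_degree :: "int \<Rightarrow> ('n::finite \<Rightarrow>\<^sub>0 nat) set" where
  "monoms_of_int_degree d = {\<mu>. int (monom_degree \<mu>) = d}"

lemma monoms_of_int_degree_eq:
  "monoms_of_int_degree d = (if d < 0 then {} else monoms_of_degree (nat d))"
  by (auto simp: monoms_of_int_degree_def monoms_of_degree_def)

lemma finite_monoms_of_int_degree: "finite (monoms_of_int_degree d)"
  by (simp add: monoms_of_int_degree_eq finite_monoms_of_degree)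

text \<open>The degree \<open>m\<close> part of a graded free module with basis degrees
  \<open>\<epsilon> p\<close>. Vectors are functions on \<open>nat\<close> vanishing beyond the
  rank, so that all modules of a resolution live in one vector space.\<close>

definition graded_piece :: "nat \<Rightarrow> (nat \<Rightarrow> int) \<Rightarrow> int \<Rightarrow> (nat \<Rightarrow> ('n::finite, 'k::field) mpoly) set" where
  "graded_piece \<rho> \<epsilon> m = {v. (\<forall>p<\<rho>. homogeneous_of_degree (m - \<epsilon> p) (v p)) \<and> (\<forall>p\<ge>\<rho>. v p = 0)}"

lemma subspace_graded_piece: "VS.subspace (graded_piece \<rho> \<epsilon> m)"
  by (rule VS.subspaceI)
    (auto simp: graded_piece_def vscale_def homogeneous_zero intro: homogeneous_add homogeneous_const_mult)

text \<open>The basis consists of monomials placed in one coordinate.\<close>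

lemma graded_piece_basis:
  fixes \<rho> :: nat and \<epsilon> :: "nat \<Rightarrow> int" and m :: int
  shows "\<exists>B :: (nat \<Rightarrow> ('n::finite, 'k::field) mpoly) set. finite B \<and> VS.independent B \<and>
    B \<subseteq> graded_piece \<rho> \<epsilon> m \<and> graded_piece \<rho> \<epsilon> m \<subseteq> VS.span B \<and>
    card B = (\<Sum>q<\<rho>. card (monoms_of_int_degree (m - \<epsilon> q) :: ('n \<Rightarrow>\<^sub>0 nat) set))"
proof -
  let ?X = "SIGMA q:{..<\<rho>}. (monoms_of_int_degree (m - \<epsilon> q) :: ('n \<Rightarrow>\<^sub>0 nat) set)"
  define v :: "nat \<times> ('n \<Rightarrow>\<^sub>0 nat) \<Rightarrow> nat \<Rightarrow> ('n, 'k) mpoly" where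
    "v = (\<lambda>(q, \<mu>) p. if p = q then Poly_Mapping.single \<mu> 1 else 0)"
  have fin: "finite ?X" by (simp add: finite_monoms_of_int_degree)
  have coord: "\<exists>i\<in>Y. Poly_Mapping.lookup (v i (fst i)) (snd i) \<noteq> 0 \<and>
        (\<forall>j\<in>Y. j \<noteq> i \<longrightarrow> Poly_Mapping.lookup (v j (fst i)) (snd i) = 0)" if Y: "Y \<noteq> {}" for Y
  proof -
    obtain i where "i \<in> Y" using Y by blast
    then show ?thesis by (intro bexI[of _ i]) (auto simp: v_def lookup_single when_def split: prod.splits)
  qed
  note ind = independent_by_coordinates[OF fin coord]
  have sub: "v ` ?X \<subseteq> graded_piece \<rho> \<epsilon> m"
    by (auto simp: v_def graded_piece_def homogeneous_of_degree_def monoms_of_int_degree_def split: if_splits)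
  have "w \<in> VS.span (v ` ?X)" if w: "w \<in> graded_piece \<rho> \<epsilon> m" for w
  proof -
    have "w = (\<Sum>x\<in>?X. vscale (Poly_Mapping.lookup (w (fst x)) (snd x)) (v x))"
    proof (rule ext, rule poly_mapping_eqI)
      fix p \<nu>
      have "Poly_Mapping.lookup ((\<Sum>x\<in>?X. vscale (Poly_Mapping.lookup (w (fst x)) (snd x)) (v x)) p) \<nu>
          = (\<Sum>x\<in>?X. if x = (p, \<nu>) then Poly_Mapping.lookup (w p) \<nu> else 0)"
        unfolding sum_fun_apply lookup_sum vscale_def lookup_const_mult
        by (rule sum.cong) (auto simp: v_def lookup_single when_def split: if_splits)
      also have "\<dots> = (if (p, \<nu>) \<in> ?X then Poly_Mapping.lookup (w p) \<nu> else 0)"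
        using fin by simp
      also have "\<dots> = Poly_Mapping.lookup (w p) \<nu>"
      proof -
        have "(p, \<nu>) \<in> ?X" if "Poly_Mapping.lookup (w p) \<nu> \<noteq> 0"
        proof -
          have k: "\<nu> \<in> Poly_Mapping.keys (w p)" using that by (simp add: in_keys_iff)
          then have p: "p < \<rho>" using w by (cases "p < \<rho>") (auto simp: graded_piece_def)
          then have "homogeneous_of_degree (m - \<epsilon> p) (w p)" using w by (simp add: graded_piece_def)
          then show ?thesis using k p by (simp add: homogeneous_of_degree_def monoms_of_int_degree_def)
        qed
        then show ?thesis by auto
      qed
      finally show "Poly_Mapping.lookup (w p) \<nu>
          = Poly_Mapping.lookup ((\<Sum>x\<in>?X. vscale (Poly_Mapping.lookup (w (fst x)) (snd x)) (v x)) p) \<nu>" by simp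
    qed
    moreover have "\<dots> \<in> VS.span (v ` ?X)"
      by (intro VS.span_sum VS.span_scale VS.span_base) auto
    ultimately show ?thesis by metis
  qed
  moreover have "card (v ` ?X) = (\<Sum>q<\<rho>. card (monoms_of_int_degree (m - \<epsilon> q) :: ('n \<Rightarrow>\<^sub>0 nat) set))"
    using card_image[OF ind(1)] by (simp add: card_SigmaI finite_monoms_of_int_degree)
  ultimately show ?thesis using ind(2) sub fin by (intro exI[of _ "v ` ?X"]) auto
qed

lemma dim_graded_piece:
  "VS.dim (graded_piece \<rho> \<epsilon> m :: (nat \<Rightarrow> ('n::finite, 'k::field) mpoly) set)
    = (\<Sum>q<\<rho>. card (monoms_of_int_degree (m - \<epsilon> q) :: ('n \<Rightarrow>\<^sub>0 nat) set))"
  using graded_piece_basis[of \<rho> \<epsilon> m] VS.basis_card_eq_dim by metis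

lemma graded_piece_finite_span:
  "\<exists>B. finite B \<and> graded_piece \<rho> \<epsilon> m \<subseteq> VS.span (B :: (nat \<Rightarrow> ('n::finite, 'k::field) mpoly) set)"
  using graded_piece_basis[of \<rho> \<epsilon> m] by metis

section \<open>Hilbert function of the resolved ideal\<close>

context minimal_resolution
begin

definition boundary :: "nat \<Rightarrow> (nat \<Rightarrow> ('n, 'k) mpoly) \<Rightarrow> nat \<Rightarrow> ('n, 'k) mpoly" where
  "boundary i v = (\<lambda>p. if p < r i then \<Sum>q<r (Suc i). A (Suc i) $$ (p, q) * v q else 0)"

abbreviation piece :: "nat \<Rightarrow> int \<Rightarrow> (nat \<Rightarrow> ('n, 'k) mpoly) set" where
  "piece i m \<equiv> graded_piece (r i) (e i) m"

lemma linear_boundary: "Vector_Spaces.linear vscale vscale (boundary i)"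
proof -
  have "boundary i (v + w) = boundary i v + boundary i w" for v w
    by (auto simp: boundary_def fun_eq_iff distrib_left sum.distrib)
  moreover have "boundary i (vscale c v) = vscale c (boundary i v)" for c v
    by (auto simp: boundary_def vscale_def fun_eq_iff sum_distrib_left ac_simps)
  ultimately show ?thesis
    unfolding Vector_Spaces.linear_iff using VS.vector_space_axioms by blast
qed

lemma boundary_eq_0_iff:
  "boundary i v = 0 \<longleftrightarrow> (\<forall>p<r i. (\<Sum>q<r (Suc i). A (Suc i) $$ (p, q) * v q) = 0)"
  by (auto simp: boundary_def fun_eq_iff)

lemma boundary_piece:
  assumes "v \<in> piece (Suc i) m"
  shows "boundary i v \<in> piece i m"
proof -
  have "homogeneous_of_degree (m - e i p) (\<Sum>q<r (Suc i). A (Suc i) $$ (p, q) * v q)" if p: "p < r i" for p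
  proof (rule homogeneous_sum)
    fix q assume "q \<in> {..<r (Suc i)}"
    then have q: "q < r (Suc i)" by simp
    have "homogeneous_of_degree (m - e (Suc i) q) (v q)" using assms q by (simp add: graded_piece_def)
    then show "homogeneous_of_degree (m - e i p) (A (Suc i) $$ (p, q) * v q)"
      using homogeneous_mult[OF entry_homogeneous[OF p q]] by fastforce
  qed
  then show ?thesis by (auto simp: graded_piece_def boundary_def)
qed

text \<open>A preimage need not be homogeneous; replacing its coordinates by their components of the
  right degree (\<open>u'\<close>) does not change the image, which is homogeneous.\<close>

lemma graded_exact:
  "{v \<in> piece (Suc i) m. boundary i v = 0} = boundary (Suc i) ` piece (Suc (Suc i)) m"
proof (intro subset_antisym subsetI)
  fix v assume "v \<in> boundary (Suc i) ` piece (Suc (Suc i)) m"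
  then obtain u where u: "u \<in> piece (Suc (Suc i)) m" "v = boundary (Suc i) u" by blast
  have "\<forall>p<r i. (\<Sum>q<r (Suc i). A (Suc i) $$ (p, q) * v q) = 0"
    unfolding exact by (rule exI[of _ u]) (simp add: u(2) boundary_def)
  then show "v \<in> {v \<in> piece (Suc i) m. boundary i v = 0}"
    using boundary_piece[OF u(1)] u(2) boundary_eq_0_iff by simp
next
  fix v assume "v \<in> {v \<in> piece (Suc i) m. boundary i v = 0}"
  then have v: "v \<in> piece (Suc i) m" "boundary i v = 0" by simp_all
  obtain u where u: "\<And>q. q < r (Suc i) \<Longrightarrow> v q = (\<Sum>l<r (Suc (Suc i)). A (Suc (Suc i)) $$ (q, l) * u l)"
    using v(2) unfolding boundary_eq_0_iff exact by blast
  define u' where "u' l = (if l < r (Suc (Suc i)) then hom_part (m - e (Suc (Suc i)) l) (u l) else 0)" for l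
  have "u' \<in> piece (Suc (Suc i)) m" by (simp add: graded_piece_def u'_def homogeneous_hom_part)
  moreover have "v = boundary (Suc i) u'"
  proof (rule ext)
    fix q
    show "v q = boundary (Suc i) u' q"
    proof (cases "q < r (Suc i)")
      case True
      have "homogeneous_of_degree (m - e (Suc i) q) (v q)" using v(1) True by (simp add: graded_piece_def)
      then have "v q = hom_part (m - e (Suc i) q) (v q)" by (simp add: hom_part_homogeneous)
      also have "\<dots> = (\<Sum>l<r (Suc (Suc i)). hom_part (m - e (Suc i) q) (A (Suc (Suc i)) $$ (q, l) * u l))"
        unfolding u[OF True] by (rule hom_part_sum)
      also have "\<dots> = (\<Sum>l<r (Suc (Suc i)). A (Suc (Suc i)) $$ (q, l) * u' l)"
        by (rule sum.cong) (simp_all add: u'_def hom_part_mult[OF entry_homogeneous[OF True]])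
      finally show ?thesis using True by (simp add: boundary_def)
    next
      case False
      then show ?thesis using v(1) by (simp add: boundary_def graded_piece_def)
    qed
  qed
  ultimately show "v \<in> boundary (Suc i) ` piece (Suc (Suc i)) m" by blast
qed

lemma dim_piece_Suc:
  "VS.dim (piece (Suc i) m) = VS.dim (boundary i ` piece (Suc i) m) + VS.dim (boundary (Suc i) ` piece (Suc (Suc i)) m)"
proof -
  obtain B where B: "finite B" "piece (Suc i) m \<subseteq> VS.span B" using graded_piece_finite_span by blast
  interpret Vector_Spaces.linear vscale vscale "boundary i" by (rule linear_boundary)
  show ?thesis
    using dim_kernel_plus_image[OF subspace_graded_piece B] unfolding graded_exact by simp
qed

text \<open>By \<open>dim_piece_Suc\<close> each dimension is a sum of two consecutive ranks, so the
  alternating sum telescopes.\<close>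

lemma euler_characteristic:
  "(\<Sum>i<k. (-1) ^ i * int (VS.dim (piece (Suc i) m)))
    = int (VS.dim (boundary 0 ` piece 1 m)) - (-1) ^ k * int (VS.dim (boundary k ` piece (Suc k) m))"
  by (induction k) (simp_all add: dim_piece_Suc algebra_simps)

lemma dim_boundary_last: "VS.dim (boundary CARD('n) ` piece (Suc CARD('n)) m) = 0"
proof -
  have "boundary CARD('n) ` piece (Suc CARD('n)) m \<subseteq> VS.span {}"
    using r_large[of "Suc CARD('n)"] by (auto simp: boundary_def fun_eq_iff)
  from VS.dim_le_card[OF this] show ?thesis by simp
qed

text \<open>The image of \<open>boundary 0\<close> is the degree \<open>m\<close> part of
  \<open>J\<close>, placed in coordinate 0. The last rank vanishes because the module after position
  n is zero.\<close>

lemma hilbert_function_ideal: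
  "int (VS.dim (boundary 0 ` piece 1 m)) = (\<Sum>i<CARD('n). (-1) ^ i * int (VS.dim (piece (Suc i) m)))"
  using euler_characteristic[where k = "CARD('n)" and m = m] dim_boundary_last[of m] by simp

lemma dim_ideal_le: "VS.dim (boundary 0 ` piece 1 m) \<le> card (monoms_of_int_degree m :: ('n \<Rightarrow>\<^sub>0 nat) set)"
proof -
  obtain B :: "(nat \<Rightarrow> ('n, 'k) mpoly) set" where B: "finite B" "piece 0 m \<subseteq> VS.span B"
    "card B = (\<Sum>q<r 0. card (monoms_of_int_degree (m - e 0 q) :: ('n \<Rightarrow>\<^sub>0 nat) set))"
    using graded_piece_basis[of "r 0" "e 0" m] by metis
  have "boundary 0 ` piece 1 m \<subseteq> piece 0 m" using boundary_piece by auto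
  then have "VS.dim (boundary 0 ` piece 1 m) \<le> card B" using B VS.dim_le_card by (meson subset_trans)
  then show ?thesis using B(3) r0 e0 by simp
qed

definition lead_monoms :: "('n \<Rightarrow> nat) \<Rightarrow> ('n \<Rightarrow>\<^sub>0 nat) set" where
  "lead_monoms \<iota> = {\<mu>. \<exists>f\<in>J. is_lead \<iota> f \<mu>}"

text \<open>Elements with distinct leading monomials are independent: in any finite collection the
  smallest leading monomial occurs in one element only.\<close>

lemma dim_ideal_ge:
  assumes inj: "inj \<iota>"
  shows "card (lead_monoms \<iota> \<inter> monoms_of_int_degree m) \<le> VS.dim (boundary 0 ` piece 1 m)"
proof -
  let ?X = "lead_monoms \<iota> \<inter> monoms_of_int_degree m"
  have fin: "finite ?X" by (simp add: finite_monoms_of_int_degree)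
  have "\<exists>f. f \<in> J \<and> homogeneous_of_degree m f \<and> is_lead \<iota> f \<mu>" if mu: "\<mu> \<in> ?X" for \<mu>
  proof -
    obtain f where f: "f \<in> J" "is_lead \<iota> f \<mu>" using mu by (auto simp: lead_monoms_def)
    \<comment> \<open>Passing to the component of degree \<open>m\<close> keeps \<open>\<mu>\<close>
      and only discards other monomials.\<close>
    have "is_lead \<iota> (hom_part m f) \<mu>"
    proof -
      have "Poly_Mapping.keys (hom_part m f) \<subseteq> Poly_Mapping.keys f"
        by (auto simp: in_keys_iff lookup_hom_part split: if_splits)
      moreover have "\<mu> \<in> Poly_Mapping.keys (hom_part m f)"
        using f(2) mu by (auto simp: is_lead_def in_keys_iff lookup_hom_part monoms_of_int_degree_def)
      ultimately show ?thesis using f(2) unfolding is_lead_def by blast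
    qed
    then show ?thesis using hom_part_mem_J[OF f(1)] homogeneous_hom_part by blast
  qed
  then obtain g where g: "\<And>\<mu>. \<mu> \<in> ?X \<Longrightarrow> g \<mu> \<in> J \<and> homogeneous_of_degree m (g \<mu>) \<and> is_lead \<iota> (g \<mu>) \<mu>"
    by metis
  define v where "v \<mu> p = (if p = 0 then g \<mu> else 0)" for \<mu> and p :: nat
  have coord: "\<exists>\<mu>\<in>Y. Poly_Mapping.lookup (v \<mu> 0) \<mu> \<noteq> 0 \<and>
      (\<forall>\<nu>\<in>Y. \<nu> \<noteq> \<mu> \<longrightarrow> Poly_Mapping.lookup (v \<nu> 0) \<mu> = 0)" if Y: "Y \<subseteq> ?X" "Y \<noteq> {}" for Y
  proof -
    have "finite Y" using Y fin finite_subset by blast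
    then obtain \<mu> where mu: "\<mu> \<in> Y" "\<And>\<nu>. \<nu> \<in> Y \<Longrightarrow> lexkey \<iota> \<mu> \<le> lexkey \<iota> \<nu>"
      by (metis Y(2) arg_min_if_finite(1) arg_min_least)
    have "Poly_Mapping.lookup (g \<nu>) \<mu> = 0" if nu: "\<nu> \<in> Y" "\<nu> \<noteq> \<mu>" for \<nu>
    proof (rule ccontr)
      assume "Poly_Mapping.lookup (g \<nu>) \<mu> \<noteq> 0"
      then have "\<mu> \<in> Poly_Mapping.keys (g \<nu>)" by (simp add: in_keys_iff)
      moreover have "is_lead \<iota> (g \<nu>) \<nu>" using g nu(1) Y(1) by blast
      ultimately have "lexkey \<iota> \<nu> < lexkey \<iota> \<mu>" using nu(2)[symmetric] unfolding is_lead_def by blast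
      then show False using mu(2)[OF nu(1)] by simp
    qed
    moreover have "Poly_Mapping.lookup (g \<mu>) \<mu> \<noteq> 0"
    proof -
      have "is_lead \<iota> (g \<mu>) \<mu>" using g mu(1) Y(1) by blast
      then show ?thesis by (simp add: is_lead_def in_keys_iff)
    qed
    ultimately show ?thesis using mu(1) by (intro bexI[of _ \<mu>]) (simp_all add: v_def)
  qed
  note ind = independent_by_coordinates[where v = v and pos = "\<lambda>_. 0" and ex = "\<lambda>\<mu>. \<mu>", OF fin coord]
  have "v ` ?X \<subseteq> boundary 0 ` piece 1 m"
  proof
    fix x assume "x \<in> v ` ?X"
    then obtain \<mu> where mu: "\<mu> \<in> ?X" "x = v \<mu>" by blast
    obtain w where w: "g \<mu> = (\<Sum>q<r 1. A 1 $$ (0, q) * w q)" using g[OF mu(1)] mem_J_iff by blast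
    define w' where "w' l = (if l < r 1 then hom_part (m - e 1 l) (w l) else 0)" for l
    have "w' \<in> piece 1 m" by (simp add: graded_piece_def w'_def homogeneous_hom_part)
    moreover have "x = boundary 0 w'"
    proof (rule ext)
      fix p
      have "homogeneous_of_degree m (g \<mu>)" using g[OF mu(1)] by blast
      then have "g \<mu> = hom_part m (g \<mu>)" by (simp add: hom_part_homogeneous[of m])
      also have "\<dots> = (\<Sum>q<r 1. hom_part m (A 1 $$ (0, q) * w q))" unfolding w by (rule hom_part_sum)
      also have "\<dots> = (\<Sum>q<r 1. A 1 $$ (0, q) * w' q)"
        by (rule sum.cong) (simp_all add: w'_def hom_part_mult[OF generator_homogeneous[unfolded One_nat_def]])
      finally show "x p = boundary 0 w' p" using r0 by (simp add: mu(2) v_def boundary_def)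
    qed
    ultimately show "x \<in> boundary 0 ` piece 1 m" by blast
  qed
  moreover obtain B where B: "B \<subseteq> boundary 0 ` piece 1 m" "VS.independent B"
    "boundary 0 ` piece 1 m \<subseteq> VS.span B" "card B = VS.dim (boundary 0 ` piece 1 m)"
    by (rule VS.basis_exists)
  moreover have "finite B"
  proof -
    obtain B0 where "finite B0" "piece 0 m \<subseteq> VS.span B0" using graded_piece_finite_span by blast
    moreover have "boundary 0 ` piece 1 m \<subseteq> piece 0 m" using boundary_piece by auto
    ultimately show ?thesis using VS.independent_span_bound[of B0 B] B(1,2) by (meson subset_trans)
  qed
  ultimately have "card (v ` ?X) \<le> card B"
    using VS.independent_span_bound[of B "v ` ?X"] ind(2) by (meson subset_trans)
  then show ?thesis using card_image[OF ind(1)] B(4) by simp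
qed

end

subsection \<open>The numerator of the Hilbert series\<close>

text \<open>For positive exponent the bound forces the limit at 0, which is the constant term, to be
  0. Dividing by u lowers the exponent by one.\<close>

lemma coeff_zero_of_bound:
  fixes P :: "real poly"
  assumes "\<And>u. 0 < u \<Longrightarrow> u < 1 \<Longrightarrow> \<bar>poly P u\<bar> \<le> C * u ^ c"
  shows "i < c \<Longrightarrow> coeff P i = 0"
  using assms
proof (induction c arbitrary: P i)
  case (Suc c)
  obtain a Q where P: "P = pCons a Q" by (cases P)
  have "(poly P \<longlongrightarrow> poly P 0) (at_right 0)"
    by (intro tendsto_intros)
  moreover have "(poly P \<longlongrightarrow> 0) (at_right 0)"
  proof (rule tendsto_0_le[where K = 1])
    have "((\<lambda>u. C * u ^ Suc c) \<longlongrightarrow> C * 0 ^ Suc c) (at_right (0::real))"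
      by (intro tendsto_intros)
    then show "((\<lambda>u. C * u ^ Suc c) \<longlongrightarrow> 0) (at_right (0::real))" by simp
    show "eventually (\<lambda>u. norm (poly P u) \<le> norm (C * u ^ Suc c) * 1) (at_right 0)"
    proof (rule eventually_mono[OF eventually_at_right_real])
      show "(0::real) < 1" by simp
      show "norm (poly P u) \<le> norm (C * u ^ Suc c) * 1" if "u \<in> {0<..<1}" for u
        using Suc.prems(2)[of u] that by (auto intro: order_trans[OF _ abs_ge_self])
    qed
  qed
  ultimately have a: "a = 0" using tendsto_unique[of "at_right (0::real)"] P by fastforce
  show ?case
  proof (cases i)
    case 0
    then show ?thesis using P a by simp
  next
    case (Suc j)
    have "\<bar>poly Q u\<bar> \<le> C * u ^ c" if u: "0 < u" "u < 1" for u
    proof -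
      have "u * \<bar>poly Q u\<bar> \<le> u * (C * u ^ c)"
        using Suc.prems(2)[OF u] P a u by (simp add: abs_mult ac_simps)
      then show ?thesis using u by simp
    qed
    then have "coeff Q j = 0" using Suc.IH[of j Q] Suc.prems(1) \<open>i = Suc j\<close> by simp
    then show ?thesis using P \<open>i = Suc j\<close> by simp
  qed
qed simp

lemma coeff_one_minus_X_power:
  "coeff ([:1, -1:] ^ j :: real poly) i = (-1) ^ i * real (j choose i)"
proof (induction j arbitrary: i)
  case 0
  show ?case by (cases i) (simp_all add: coeff_pCons)
next
  case (Suc j)
  have "[:1, -1:] ^ Suc j = [:1, -1:] ^ j - pCons 0 ([:1, -1:] ^ j :: real poly)"
    by (simp add: mult_pCons_left)
  then show ?case by (cases i) (simp_all add: Suc.IH coeff_pCons algebra_simps del: power_Suc)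
qed

text \<open>
  Substituting \<open>t = 1 - u\<close>, the bound gives \<open>(1 - u)\<^sup>N R(u) \<equiv> 1\<close> modulo \<open>u\<^sup>c\<close> for
  \<open>R(u) = (\<Sum>j<n. (-1)\<^sup>j b\<^sub>j (1 - u)\<^sup>j)\<close>, and the coefficients of \<open>(1 - u)\<^sup>-\<^sup>N\<close> are the binomial
  coefficients on the right-hand side.
\<close>

lemma coefficients_of_vanishing_order:
  fixes b :: "nat \<Rightarrow> real"
  assumes N: "0 < N" and i: "i < c"
    and bound: "\<And>t. 0 < t \<Longrightarrow> t < 1 \<Longrightarrow>
      \<bar>1 - t ^ N * (\<Sum>j<n. (-1) ^ j * b j * t ^ j)\<bar> \<le> C * (1 - t) ^ c"
  shows "(\<Sum>j<n. (-1) ^ (i + j) * real (j choose i) * b j) = real ((N + i - 1) choose i)"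
proof -
  let ?X = "[:1, -1:] :: real poly"
  define R where "R = (\<Sum>j<n. smult ((-1) ^ j * b j) (?X ^ j))"
  define P where "P = 1 - ?X ^ N * R"
  have P0: "coeff P l = 0" if "l < c" for l
  proof (rule coeff_zero_of_bound[OF _ that])
    fix u :: real assume u: "0 < u" "u < 1"
    have "poly P u = 1 - (1 - u) ^ N * (\<Sum>j<n. (-1) ^ j * b j * (1 - u) ^ j)"
      by (simp add: P_def R_def poly_sum)
    then show "\<bar>poly P u\<bar> \<le> C * u ^ c" using bound[of "1 - u"] u by simp
  qed
  define F where "F = (1 - fps_X :: real fps) ^ N"
  have fX: "fps_of_poly ?X = 1 - fps_X"
    by (simp add: fps_of_poly_pCons)
  have "F * fps_of_poly R = 1 - fps_of_poly P"
    by (simp add: P_def F_def fps_of_poly_diff fps_of_poly_mult fps_of_poly_power fX)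
  moreover have "inverse F * F = 1"
    by (rule inverse_mult_eq_1) (simp add: F_def)
  ultimately have R: "fps_of_poly R = inverse F * (1 - fps_of_poly P)"
    by (metis mult.assoc mult_1)
  have "inverse F = Abs_fps (\<lambda>k. of_nat ((N + k - 1) choose k))"
    unfolding F_def using one_minus_const_fps_X_neg_power'[OF N, of 1] by simp
  then have invF: "fps_nth (inverse F) i = real ((N + i - 1) choose i)" by simp
  \<comment> \<open>Coefficient \<open>i\<close> of the product involves only coefficients of
    \<open>P\<close> of index at most \<open>i < c\<close>.\<close>
  have "fps_nth (inverse F * fps_of_poly P) i = 0"
    unfolding fps_mult_nth by (rule sum.neutral) (use P0 i in auto)
  then have "coeff R i = real ((N + i - 1) choose i)"
    using arg_cong[OF R, of "\<lambda>f. fps_nth f i"] invF by (simp add: algebra_simps)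
  moreover have "coeff R i = (\<Sum>j<n. (-1) ^ (i + j) * real (j choose i) * b j)"
    unfolding R_def coeff_sum
    by (rule sum.cong) (simp_all add: coeff_one_minus_X_power power_add ac_simps)
  ultimately show ?thesis by simp
qed

text \<open>Shifting the generator of S to degree \<open>a\<close> multiplies the Hilbert series by
  \<open>t ^ a\<close>; the case distinction guards the truncating subtraction.\<close>

lemma shifted_sums:
  fixes h :: "nat \<Rightarrow> real"
  assumes "(\<lambda>m. h m * t ^ m) sums H"
  shows "(\<lambda>m. (if a \<le> m then h (m - a) else 0) * t ^ m) sums (t ^ a * H)"
proof -
  have "(\<lambda>m. (if a \<le> m + a then h (m + a - a) else 0) * t ^ (m + a)) sums (t ^ a * H)"
    using sums_mult[OF assms, of "t ^ a"] by (simp add: power_add ac_simps)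
  then show ?thesis by (subst (asm) sums_zero_iff_shift) auto
qed

context minimal_resolution
begin

text \<open>Numerator times \<open>H\<close> is the series of the codimensions
  \<open>h m - d m\<close>, which lie between 0 and the number \<open>s m\<close> of monomials that
  are not leading. So the product is between 0 and \<open>c\<close>, and \<open>H\<close> is at
  least \<open>1 / (1 - t) ^ n\<close>.\<close>

lemma hilbert_numerator_bound:
  assumes inj: "inj \<iota>" and N: "\<And>i q. q < r (Suc i) \<Longrightarrow> e (Suc i) q = int N + int i"
    and t: "0 < t" "t < (1::real)"
    and growth: "\<And>B. finite B \<Longrightarrow> B \<subseteq> - lead_monoms \<iota> \<Longrightarrow> (\<Sum>\<mu>\<in>B. t ^ monom_degree \<mu>) \<le> c"
  shows "\<bar>1 - t ^ N * (\<Sum>j<CARD('n). (-1) ^ j * real (r (Suc j)) * t ^ j)\<bar> \<le> c * (1 - t) ^ CARD('n)"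
proof -
  let ?n = "CARD('n)"
  define h where "h m = card (monoms_of_degree m :: ('n \<Rightarrow>\<^sub>0 nat) set)" for m
  define d where "d m = VS.dim (boundary 0 ` piece 1 (int m))" for m
  define s where "s m = card (- lead_monoms \<iota> \<inter> monoms_of_degree m)" for m
  have mono: "monoms_of_int_degree (int m) = (monoms_of_degree m :: ('n \<Rightarrow>\<^sub>0 nat) set)" for m
    by (simp add: monoms_of_int_degree_eq)
  have dh: "d m \<le> h m" for m
    using dim_ideal_le[of "int m"] by (simp add: d_def h_def mono)
  have hs: "h m \<le> d m + s m" for m
  proof -
    have fin: "finite (monoms_of_degree m :: ('n \<Rightarrow>\<^sub>0 nat) set)" by (rule finite_monoms_of_degree)
    have "h m = card ((lead_monoms \<iota> \<inter> monoms_of_degree m) \<union> (- lead_monoms \<iota> \<inter> monoms_of_degree m))"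
      unfolding h_def by (rule arg_cong[where f = card]) auto
    also have "\<dots> \<le> card (lead_monoms \<iota> \<inter> monoms_of_degree m) + s m"
      unfolding s_def by (rule card_Un_le)
    also have "card (lead_monoms \<iota> \<inter> monoms_of_degree m) \<le> d m"
      using dim_ideal_ge[OF inj, of "int m"] by (simp add: d_def mono)
    finally show ?thesis by simp
  qed
  \<comment> \<open>Linearity enters here: all generators have degree \<open>N + i\<close>, so the
    piece consists of \<open>r (Suc i)\<close> copies of one shift of S.\<close>
  have dim_piece: "VS.dim (piece (Suc i) (int m)) = r (Suc i) * (if N + i \<le> m then h (m - (N + i)) else 0)" for i m
  proof -
    have "VS.dim (piece (Suc i) (int m))
        = (\<Sum>q<r (Suc i). card (monoms_of_int_degree (int m - (int N + int i)) :: ('n \<Rightarrow>\<^sub>0 nat) set))"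
      unfolding dim_graded_piece by (rule sum.cong) (simp_all add: N)
    then show ?thesis
      by (auto simp: monoms_of_int_degree_eq h_def nat_diff_distrib' nat_int_add simp flip: of_nat_add of_nat_diff)
  qed
  have d: "real (d m) = (\<Sum>i<?n. (-1) ^ i * real (r (Suc i)) * (if N + i \<le> m then real (h (m - (N + i))) else 0))" for m
  proof -
    have "real (d m) = real_of_int (\<Sum>i<?n. (-1) ^ i * int (VS.dim (piece (Suc i) (int m))))"
      using hilbert_function_ideal[of "int m"] by (metis d_def of_int_of_nat_eq)
    also have "\<dots> = (\<Sum>i<?n. (-1) ^ i * real (r (Suc i)) * (if N + i \<le> m then real (h (m - (N + i))) else 0))"
      unfolding of_int_sum by (rule sum.cong) (simp_all add: dim_piece)
    finally show ?thesis .
  qed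
  define H where "H = suminf (\<lambda>m. real (h m) * t ^ m)"
  have sumH: "(\<lambda>m. real (h m) * t ^ m) sums H"
    unfolding H_def h_def using hilbert_series_polynomial_ring(1)[OF t] by (rule summable_sums)
  have H: "1 / (1 - t) ^ ?n \<le> H"
    unfolding H_def h_def by (rule hilbert_series_polynomial_ring(2)[OF t])
  let ?Q = "\<Sum>j<?n. (-1) ^ j * real (r (Suc j)) * t ^ j"
  have "(\<lambda>m. \<Sum>i<?n. (-1) ^ i * real (r (Suc i)) * ((if N + i \<le> m then real (h (m - (N + i))) else 0) * t ^ m))
      sums (\<Sum>i<?n. (-1) ^ i * real (r (Suc i)) * (t ^ (N + i) * H))"
    by (intro sums_sum sums_mult shifted_sums[of "\<lambda>m. real (h m)"] sumH)
  moreover have "(\<Sum>i<?n. (-1) ^ i * real (r (Suc i)) * ((if N + i \<le> m then real (h (m - (N + i))) else 0) * t ^ m))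
      = real (d m) * t ^ m" for m
    unfolding d sum_distrib_right by (simp add: mult.assoc)
  moreover have "(\<Sum>i<?n. (-1) ^ i * real (r (Suc i)) * (t ^ (N + i) * H)) = t ^ N * ?Q * H"
    by (simp add: sum_distrib_left sum_distrib_right power_add ac_simps)
  ultimately have "(\<lambda>m. real (d m) * t ^ m) sums (t ^ N * ?Q * H)" by simp
  then have sumHd: "(\<lambda>m. real (h m) * t ^ m - real (d m) * t ^ m) sums ((1 - t ^ N * ?Q) * H)"
    using sums_diff[OF sumH] by (simp add: algebra_simps)
  have s: "summable (\<lambda>m. real (s m) * t ^ m)" "suminf (\<lambda>m. real (s m) * t ^ m) \<le> c"
    unfolding s_def using hilbert_series_summable[OF t(1) growth] by auto
  have le: "real (h m) * t ^ m - real (d m) * t ^ m \<le> real (s m) * t ^ m" for m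
  proof -
    have "(real (h m) - real (d m)) * t ^ m \<le> real (s m) * t ^ m"
      by (rule mult_right_mono) (use hs[of m] t in auto)
    then show ?thesis by (simp add: algebra_simps)
  qed
  have "(1 - t ^ N * ?Q) * H \<le> suminf (\<lambda>m. real (s m) * t ^ m)"
    by (rule sums_le[OF le sumHd summable_sums[OF s(1)]])
  then have up: "(1 - t ^ N * ?Q) * H \<le> c" using s(2) by simp
  \<comment> \<open>The sign comes first: \<open>H\<close> may be replaced by its lower bound only
    if the other factor is non-negative.\<close>
  have "0 \<le> (1 - t ^ N * ?Q) * H"
  proof (rule sums_le[OF _ sums_zero sumHd])
    show "0 \<le> real (h m) * t ^ m - real (d m) * t ^ m" for m
      using mult_right_mono[of "real (d m)" "real (h m)" "t ^ m"] dh[of m] t by simp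
  qed
  moreover have Hpos: "0 < H" using H t by (intro less_le_trans[OF _ H]) simp
  ultimately have nonneg: "0 \<le> 1 - t ^ N * ?Q" by (simp add: zero_le_mult_iff)
  have "1 - t ^ N * ?Q = (1 - t ^ N * ?Q) * (1 / (1 - t) ^ ?n) * (1 - t) ^ ?n" using t by simp
  also have "\<dots> \<le> c * (1 - t) ^ ?n"
  proof (rule mult_right_mono)
    have "(1 - t ^ N * ?Q) * (1 / (1 - t) ^ ?n) \<le> (1 - t ^ N * ?Q) * H"
      by (rule mult_left_mono[OF H nonneg])
    then show "(1 - t ^ N * ?Q) * (1 / (1 - t) ^ ?n) \<le> c" using up by linarith
  qed (use t in simp)
  finally show ?thesis using nonneg by simp
qed

end

section \<open>Binomial identities for the Betti numbers of powers\<close>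

theorem theorem2p1:
  fixes I :: "('n::finite, 'k::field) mpoly set" and d k :: nat
  assumes "homogeneous_ideal I" and "I \<noteq> UNIV"
    and "has_linear_powers I"
    and "generated_in_degree d I"
    and "k \<ge> 1"
  shows "let n = CARD('n); c = the_enat (enat n - ideal_dim I) in
    mat c n (\<lambda>(i, j). (- 1) ^ (i + j) * int (j choose i))
        *\<^sub>v vec n (\<lambda>j. int (betti (Suc j) (ideal_power I k)))
      = vec c (\<lambda>i. int ((d * k + i - 1) choose i))"
proof -
  let ?n = "CARD('n)" and ?c = "the_enat (enat CARD('n) - ideal_dim I)"
  have I: "ideal I class_ring" using assms(1) by (simp add: homogeneous_ideal_def)
  \<comment> \<open>The resolution of \<open>I\<close> itself supplies a minimal generating set to
    which \<open>generated_in_degree\<close> applies.\<close>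
  obtain r1 e1 A1 where "minimal_graded_free_resolution (ideal_power I 1) r1 e1 A1"
    using assms(3) by (auto simp: has_linear_powers_def has_linear_resolution_def)
  then interpret R1: minimal_resolution I r1 e1 A1
    unfolding ideal_power_1[OF I] by unfold_locales
  have deg1: "homogeneous_of_degree (int d) (A1 1 $$ (0, q))" if "q < r1 1" for q
    using assms(4) R1.minimal_generators that unfolding generated_in_degree_def by blast
  have genI: "I \<subseteq> genideal class_ring {g \<in> I. homogeneous_of_degree (int d) g}"
  proof -
    have "I = genideal class_ring {A1 1 $$ (0, q) | q. q < r1 1}"
      using R1.minimal_generators
      by (simp add: minimal_homogeneous_generating_set_def homogeneous_generating_set_def)
    also have "\<dots> \<subseteq> genideal class_ring {g \<in> I. homogeneous_of_degree (int d) g}"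
      by (rule genideal_least[OF genideal_ideal_class_ring], rule subset_trans[OF _ genideal_superset])
        (use deg1 R1.generator_mem_J in auto)
    finally show ?thesis .
  qed
  obtain r e A where minimal: "minimal_graded_free_resolution (ideal_power I k) r e A"
    and linear: "\<And>i p q. i > 1 \<Longrightarrow> p < r (i - 1) \<Longrightarrow> q < r i \<Longrightarrow> A i $$ (p, q) \<noteq> 0 \<Longrightarrow>
        homogeneous_of_degree 1 (A i $$ (p, q))"
    using assms(3,5) unfolding has_linear_powers_def has_linear_resolution_def by metis
  interpret R: minimal_resolution "ideal_power I k" r e A using minimal by unfold_locales
  have deg: "e (Suc i) q = int (d * k) + int i" if "q < r (Suc i)" for i q
    using R.linear_degrees[OF linear ideal_power_generated[OF I genI, of k] that] by simp
  have betti: "betti (Suc j) (ideal_power I k) = r (Suc j)" for j by (rule betti_eq[OF minimal])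
  have "(\<Sum>j<?n. (-1) ^ (i + j) * int (j choose i) * int (r (Suc j))) = int ((d * k + i - 1) choose i)"
    if i: "i < ?c" for i
  proof -
    \<comment> \<open>If dim I is at least n, infinity included, the subtraction yields 0 and there
      is no row \<open>i\<close>.\<close>
    have dim: "ideal_dim I < enat ?n"
    proof (rule ccontr)
      assume "\<not> ?thesis"
      then have "enat ?n - ideal_dim I = enat 0"
        by (cases "ideal_dim I") (simp_all add: zero_enat_def)
      then show False using i by simp
    qed
    then obtain \<delta> where \<delta>: "ideal_dim I = enat \<delta>" "\<delta> < ?n" by (cases "ideal_dim I") auto
    have c: "?c = ?n - \<delta>" using \<delta> by simp
    obtain \<iota> :: "'n \<Rightarrow> nat" where inj: "inj \<iota>"
      using finite_imp_inj_to_nat_seg[of "UNIV :: 'n set"] by auto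
    have meets: "\<exists>\<mu>\<in>R.lead_monoms \<iota>. Poly_Mapping.keys \<mu> \<subseteq> U" if U: "card U > \<delta>" for U
    proof (rule ccontr)
      assume neg: "\<not> ?thesis"
      have "enat (card U) \<le> ideal_dim I"
        by (rule card_independent_le_ideal_dim[OF inj I, of k]) (use neg in \<open>auto simp: R.lead_monoms_def\<close>)
      then show False using U \<delta>(1) by simp
    qed
    \<comment> \<open>As dim I < n, not even the set of all variables is avoided, so the power is
      nonzero and has a generator. By minimality this has no constant term, so its degree is
      positive.\<close>
    have N: "0 < d * k"
    proof -
      obtain \<mu> f where f: "f \<in> ideal_power I k" "is_lead \<iota> f \<mu>"
        using meets[of UNIV] \<delta>(2) by (auto simp: R.lead_monoms_def)
      then have "f \<noteq> 0" by (auto simp: is_lead_def)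
      obtain w where "f = (\<Sum>q<r 1. A 1 $$ (0, q) * w q)" using f(1) R.mem_J_iff by blast
      with \<open>f \<noteq> 0\<close> have "r 1 \<noteq> 0" by (cases "r 1 = 0") simp_all
      then have q: "0 < r (Suc 0)" by simp
      obtain p where p: "p < r 0" "A 1 $$ (p, 0) \<noteq> 0" using R.column_nonzero[OF q] by auto
      then have nz: "A 1 $$ (0, 0) \<noteq> 0" using R.r0 by simp
      have const: "Poly_Mapping.lookup (A 1 $$ (0, 0)) 0 = 0"
        using minimal q R.r0 by (simp add: minimal_graded_free_resolution_def)
      have hom: "homogeneous_of_degree (int (d * k)) (A 1 $$ (0, 0))"
        using R.generator_homogeneous[of 0] deg[OF q] q by simp
      obtain \<nu> where \<nu>: "\<nu> \<in> Poly_Mapping.keys (A 1 $$ (0, 0))" using nz by (metis keys_eq_empty ex_in_conv)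
      show ?thesis
      proof (rule ccontr)
        assume "\<not> ?thesis"
        then have "monom_degree \<nu> = 0" using hom \<nu> by (auto simp: homogeneous_of_degree_def)
        then have "\<nu> = 0" unfolding monom_degree_def by (intro poly_mapping_eqI) simp
        then show False using \<nu> const by (simp add: in_keys_iff)
      qed
    qed
    have "\<exists>C\<ge>0. \<forall>t B. 0 < t \<longrightarrow> t < (1::real) \<longrightarrow> finite B \<longrightarrow> B \<subseteq> - R.lead_monoms \<iota> \<longrightarrow>
        (\<Sum>\<mu>\<in>B. t ^ monom_degree \<mu>) \<le> C / (1 - t) ^ \<delta>"
    proof (rule growth_of_standard_monomials)
      fix U :: "'n set" assume "card U = Suc \<delta>"
      then obtain l where l: "l \<in> R.lead_monoms \<iota>" "Poly_Mapping.keys l \<subseteq> U" using meets[of U] by auto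
      obtain f where f: "f \<in> ideal_power I k" "is_lead \<iota> f l" using l(1) by (auto simp: R.lead_monoms_def)
      \<comment> \<open>Leading monomials of an ideal are closed under multiples, so a monomial that
        is not leading is not divisible by \<open>l\<close>.\<close>
      have "\<exists>x. Poly_Mapping.lookup \<mu> x < Poly_Mapping.lookup l x" if mu: "\<mu> \<in> - R.lead_monoms \<iota>" for \<mu>
      proof (rule ccontr)
        assume "\<not> ?thesis"
        then have "(\<mu> - l) + l = \<mu>"
          by (intro poly_mapping_eqI) (simp add: lookup_add lookup_minus not_less)
        moreover have "is_lead \<iota> (Poly_Mapping.single (\<mu> - l) 1 * f) ((\<mu> - l) + l)"
          by (rule is_lead_mult[OF inj _ f(2)]) (simp add: is_lead_def)
        moreover have "Poly_Mapping.single (\<mu> - l) 1 * f \<in> ideal_power I k"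
          by (rule class_ring_idealD(3)[OF R.ideal_J f(1)])
        ultimately show False using mu by (auto simp: R.lead_monoms_def)
      qed
      then show "\<exists>l. Poly_Mapping.keys l \<subseteq> U \<and>
          (\<forall>\<mu>\<in>- R.lead_monoms \<iota>. \<exists>x. Poly_Mapping.lookup \<mu> x < Poly_Mapping.lookup l x)"
        using l(2) by blast
    qed
    then obtain C where C: "\<And>t B. 0 < t \<Longrightarrow> t < (1::real) \<Longrightarrow> finite B \<Longrightarrow> B \<subseteq> - R.lead_monoms \<iota> \<Longrightarrow>
        (\<Sum>\<mu>\<in>B. t ^ monom_degree \<mu>) \<le> C / (1 - t) ^ \<delta>" by blast
    have "\<bar>1 - t ^ (d * k) * (\<Sum>j<?n. (-1) ^ j * real (r (Suc j)) * t ^ j)\<bar> \<le> C * (1 - t) ^ ?c"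
      if t: "0 < t" "t < 1" for t
    proof -
      have "\<bar>1 - t ^ (d * k) * (\<Sum>j<?n. (-1) ^ j * real (r (Suc j)) * t ^ j)\<bar> \<le> C / (1 - t) ^ \<delta> * (1 - t) ^ ?n"
        by (rule R.hilbert_numerator_bound[OF inj deg t C[OF t]])
      also have "(1 - t) ^ ?n = (1 - t) ^ \<delta> * (1 - t) ^ ?c"
        unfolding c power_add[symmetric] using \<delta>(2) by simp
      also have "C / (1 - t) ^ \<delta> * ((1 - t) ^ \<delta> * (1 - t) ^ ?c) = C * (1 - t) ^ ?c" using t by simp
      finally show ?thesis .
    qed
    then have "(\<Sum>j<?n. (-1) ^ (i + j) * real (j choose i) * real (r (Suc j))) = real ((d * k + i - 1) choose i)"
      by (intro coefficients_of_vanishing_order[OF N i])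
    then have "real_of_int (\<Sum>j<?n. (-1) ^ (i + j) * int (j choose i) * int (r (Suc j)))
        = real_of_int (int ((d * k + i - 1) choose i))" by simp
    then show ?thesis by (simp only: of_int_eq_iff)
  qed
  then show ?thesis
    unfolding Let_def betti
    by (intro eq_vecI) (simp_all add: scalar_prod_def atLeast0LessThan)
qed

end
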